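(* Let $d\ge1$, $s\in(0,1)$, $0<\lambda\le\Lambda$ and $M\ge0$. There exists $\delta>0$, depending only on $d,s,\lambda,\Lambda,M$, with the following property. Let $R>0$, let $K:\mathbb{R}^d\to\mathbb{R}$ be a measurable kernel satisfying $\lambda|y|^{-d-s}\le K(y)\le\Lambda|y|^{-d-s}$ and $K(y)=K(-y)$ for all $y\ne0$, and let $E\subset\mathbb{R}^d$ be a Borel set with $0\in\partial E$. Suppose that $H_{K,E}\le MR^{-s}$ in $B_{R/2}$ in the viscosity sense and that $|E\cap B_R|<\delta|B_R|$. Then the set \[ \{x\in\partial E\cap B_{R/4}:\ H_{K,E}(x)=+\infty\} \] has positive Lebesgue measure. Here $H_{K,E}(x)=+\infty$ means the defining limit exists and equals $+\infty$.
   Context: $B_\rho(x)$ is the open ball of radius $\rho$ centred at $x$, $B_\rho=B_\rho(0)$, and $|F|$ denotes Lebesgue measure. Sets are not identified up to null sets, and $\partial E$ is the topological boundary. Put $\tilde\chi_E=\chi_{\mathbb{R}^d\setminus E}-\chi_E$. The nonlocal mean curvature of $E$ at $x\in\partial E$ is \[ H_{K,E}(x)=\lim_{\varepsilon\to0^+}\int_{\mathbb{R}^d\setminus B_\varepsilon(x)}\tilde\chi_E(y)K(x-y)\,dy, \] whenever the limit exists (possibly $+\infty$). It exists in $(-\infty,+\infty]$ at boundary points admitting an exterior touching ball. "$H_{K,E}\le C_0$ in an open set $\Omega$ in the viscosity sense" means the following. Take any $x\in\partial E\cap\Omega$ for which there is an open ball $B\subset\mathbb{R}^d\setminus E$ with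 $x\in\partial B$. At every such $x$ one has $H_{K,E}(x)\le C_0$. *)

theory Defs
  imports "HOL-Analysis.Analysis"
begin

definition tchi :: "'a set \<Rightarrow> 'a \<Rightarrow> real" where
  "tchi E y = (if y \<in> E then -1 else 1)"

definition nmc_trunc :: "('a::euclidean_space \<Rightarrow> real) \<Rightarrow> 'a set \<Rightarrow> 'a \<Rightarrow> real \<Rightarrow> real" where
  "nmc_trunc K E x e = (LINT y : (UNIV - ball x e) | lebesgue. tchi E y * K (x - y))"

text \<open>Nonlocal mean curvature H_{K,E}(x), as an extended real: the limit as eps -> 0+
  (meaningful whenever the limit exists in the extended reals).\<close>
definition nmc :: "('a::euclidean_space \<Rightarrow> real) \<Rightarrow> 'a set \<Rightarrow> 'a \<Rightarrow> ereal" where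
  "nmc K E x = Lim (at_right 0) (\<lambda>e. ereal (nmc_trunc K E x e))"

definition exterior_touching_ball :: "'a::euclidean_space set \<Rightarrow> 'a \<Rightarrow> bool" where
  "exterior_touching_ball E x \<longleftrightarrow> (\<exists>c r. r > 0 \<and> ball c r \<subseteq> UNIV - E \<and> x \<in> frontier (ball c r))"

definition nmc_le_visc :: "('a::euclidean_space \<Rightarrow> real) \<Rightarrow> 'a set \<Rightarrow> 'a set \<Rightarrow> real \<Rightarrow> bool" where
  "nmc_le_visc K E \<Omega> C0 \<longleftrightarrow>
     (\<forall>x \<in> frontier E \<inter> \<Omega>. exterior_touching_ball E x \<longrightarrow> nmc K E x \<le> ereal C0)"

end

theory Submission
  imports Defs "HOL-Real_Asymp.Real_Asymp"
begin

text \<open>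
  By Lebesgue's density theorem, almost every point of \<open>\<partial>E\<close> outside \<open>E\<close> has curvature
  \<open>+\<infinity>\<close> and almost every point inside \<open>E\<close> has curvature \<open>-\<infinity>\<close>; so up to a null set the set in
  question is the part of \<open>closure E - E\<close> in \<open>B\<^bsub>R/4\<^esub>\<close>. Suppose this is null. As
  \<open>E\<close> has small measure in \<open>B\<^bsub>R\<^esub>\<close>, the maximal inequality provides a point \<open>z \<in> B\<^bsub>R/16\<^esub>\<close> outside
  \<open>closure E\<close> around which \<open>E\<close> has small density at every scale up to \<open>R/4\<close>. Let \<open>x\<close> be a
  nearest point of \<open>closure E\<close> and \<open>r = |x - z| \<le> R/16\<close>. The ball \<open>B\<^bsub>r\<^esub>(z)\<close> touches \<open>E\<close> from outside at
  \<open>x\<close>, which controls the curvature integral from below at scales under \<open>\<theta>r\<close>, while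
  the small density makes the larger scales contribute at least a multiple of \<open>(\<theta>r)\<^bsup>-s\<^esup>\<close>. For small \<open>\<theta>\<close>
  the curvature at \<open>x\<close> exceeds \<open>M R\<^bsup>-s\<^esup>\<close>, contradicting the viscosity bound.
\<close>

subsection \<open>Densities on balls\<close>

lemma measure_lebesgue_ball:
  fixes x :: "'a::euclidean_space"
  assumes "0 \<le> t"
  shows "measure lebesgue (ball x t) = unit_ball_vol (real DIM('a)) * t ^ DIM('a)"
  using content_ball[OF assms, of x] by (simp add: measure_completion)

lemma measure_lebesgue_ball_scale:
  fixes x :: "'a::euclidean_space"
  assumes "0 \<le> c" "0 \<le> t"
  shows "measure lebesgue (ball x (c * t)) = c ^ DIM('a) * measure lebesgue (ball x t)"
  using assms by (simp add: measure_lebesgue_ball power_mult_distrib del: measure_completion)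

lemma lmeasurable_Int_ball: "A \<in> sets lebesgue \<Longrightarrow> A \<inter> ball x t \<in> lmeasurable"
  by (metis Int_commute fmeasurable_Int_fmeasurable lmeasurable_ball)

definition ball_density :: "'a::euclidean_space set \<Rightarrow> 'a \<Rightarrow> real \<Rightarrow> real" where
  "ball_density A x t = measure lebesgue (A \<inter> ball x t) / measure lebesgue (ball x t)"

lemma ball_density_nonneg: "0 \<le> ball_density A x t"
  by (simp add: ball_density_def)

lemma ball_density_UNIV: "0 < t \<Longrightarrow> ball_density UNIV x t = 1"
  by (simp add: ball_density_def)

lemma less_ball_density_iff:
  assumes "0 < t"
  shows "\<kappa> < ball_density A x t \<longleftrightarrow> \<kappa> * measure lebesgue (ball x t) < measure lebesgue (A \<inter> ball x t)"
proof -
  have "0 < measure lebesgue (ball x t)" using assms by simp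
  then show ?thesis by (simp add: ball_density_def pos_less_divide_eq del: measure_completion)
qed

lemma measure_Int_ball_eq:
  fixes x :: "'a::euclidean_space"
  assumes "0 < t"
  shows "measure lebesgue (A \<inter> ball x t) = ball_density A x t * (unit_ball_vol (real DIM('a)) * t ^ DIM('a))"
proof -
  have "measure lebesgue (ball x t) \<noteq> 0" using assms by simp
  then have "measure lebesgue (A \<inter> ball x t) = ball_density A x t * measure lebesgue (ball x t)"
    by (simp add: ball_density_def del: measure_completion)
  then show ?thesis using assms by (simp add: measure_lebesgue_ball del: measure_completion)
qed

lemma ball_density_Compl:
  fixes x :: "'a::euclidean_space"
  assumes A: "A \<in> sets lebesgue" and t: "0 < t"
  shows "ball_density (- A) x t = 1 - ball_density A x t"
proof -
  have "- A \<inter> ball x t = ball x t - A \<inter> ball x t" by auto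
  then have "measure lebesgue (- A \<inter> ball x t)
      = measure lebesgue (ball x t) - measure lebesgue (A \<inter> ball x t)"
    using measurable_measure_Diff[OF lmeasurable_ball fmeasurableD[OF lmeasurable_Int_ball[OF A]], of x t x t]
    by (simp del: measure_completion)
  moreover have "measure lebesgue (ball x t) \<noteq> 0" using t by simp
  ultimately show ?thesis by (simp add: ball_density_def diff_divide_distrib del: measure_completion)
qed

lemma tendsto_ball_density_Compl:
  assumes "A \<in> sets lebesgue" "(ball_density A x \<longlongrightarrow> l) (at_right 0)"
  shows "(ball_density (- A) x \<longlongrightarrow> 1 - l) (at_right 0)"
proof (rule Lim_transform_eventually)
  show "((\<lambda>t. 1 - ball_density A x t) \<longlongrightarrow> 1 - l) (at_right 0)"
    using assms(2) by (intro tendsto_diff tendsto_const)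
  show "\<forall>\<^sub>F t in at_right 0. 1 - ball_density A x t = ball_density (- A) x t"
    using ball_density_Compl[OF assms(1)] by (intro eventually_at_rightI[of 0 1]) auto
qed

lemma ball_density_le_shift:
  fixes x z :: "'a::euclidean_space"
  assumes A: "A \<in> sets lebesgue" and t: "0 < t" and r: "dist z x \<le> r"
  shows "ball_density A x t \<le> (1 + r / t) ^ DIM('a) * ball_density A z (t + r)"
proof -
  have tr: "0 < t + r" using t r zero_le_dist[of z x] by linarith
  have "ball x t \<subseteq> ball z (t + r)" using r by (simp add: ball_subset_ball_iff dist_commute)
  then have "measure lebesgue (A \<inter> ball x t) \<le> measure lebesgue (A \<inter> ball z (t + r))"
    using A by (intro measure_mono_fmeasurable lmeasurable_Int_ball fmeasurableD[OF lmeasurable_Int_ball]) auto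
  then have "ball_density A x t * t ^ DIM('a) \<le> ball_density A z (t + r) * (t + r) ^ DIM('a)"
    using t tr by (simp add: measure_Int_ball_eq mult.left_commute del: measure_completion)
  also have "(t + r) ^ DIM('a) = (1 + r / t) ^ DIM('a) * t ^ DIM('a)"
    using t by (simp add: field_simps flip: power_mult_distrib)
  finally show ?thesis using t by (simp add: mult_ac)
qed

lemma ball_density_Int_ball_le:
  fixes x :: "'a::euclidean_space"
  assumes \<sigma>: "0 < \<sigma>" "\<sigma> \<le> \<tau>"
    and dens: "\<And>t. \<sigma> \<le> t \<Longrightarrow> t \<le> \<tau> \<Longrightarrow> ball_density A x t \<le> \<kappa>" and t: "\<sigma> \<le> t"
  shows "ball_density (A \<inter> ball x \<tau>) x t \<le> \<kappa>"
proof (cases "t \<le> \<tau>")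
  case True
  then have "A \<inter> ball x \<tau> \<inter> ball x t = A \<inter> ball x t" using subset_ball[of t \<tau> x] by blast
  then show ?thesis using dens[OF t True] by (simp only: ball_density_def)
next
  case False
  have \<kappa>: "0 \<le> \<kappa>" using dens[OF \<sigma>(2) order_refl] ball_density_nonneg[of A x \<tau>] by linarith
  have "A \<inter> ball x \<tau> \<inter> ball x t = A \<inter> ball x \<tau>" using False subset_ball[of \<tau> t x] by auto
  then have "measure lebesgue (A \<inter> ball x \<tau> \<inter> ball x t) \<le> \<kappa> * measure lebesgue (ball x \<tau>)"
    using \<sigma> dens[OF \<sigma>(2) order_refl] by (simp add: less_ball_density_iff flip: not_less)
  also have "\<dots> \<le> \<kappa> * measure lebesgue (ball x t)"
    using False \<kappa> by (intro mult_left_mono measure_mono_fmeasurable) (auto intro: subset_ball)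
  finally show ?thesis using t \<sigma> by (simp add: less_ball_density_iff flip: not_less)
qed

subsection \<open>The maximal inequality and Lebesgue's density theorem\<close>

lemma measure_UN_enlarged_balls_le:
  fixes U :: "'a::euclidean_space set"
  assumes U: "U \<in> lmeasurable" and \<kappa>: "0 < \<kappa>" and I: "finite I"
    and disj: "pairwise (\<lambda>i j. disjnt (cball i (r i)) (cball j (r j))) I"
    and r: "\<And>i. i \<in> I \<Longrightarrow> 0 < r i" and dens: "\<And>i. i \<in> I \<Longrightarrow> \<kappa> < ball_density U i (r i)"
  shows "measure lebesgue (\<Union>i\<in>I. ball i (5 * r i)) \<le> 5 ^ DIM('a) / \<kappa> * measure lebesgue U"
proof -
  have enlarged: "measure lebesgue (ball i (5 * r i)) \<le> 5 ^ DIM('a) / \<kappa> * measure lebesgue (U \<inter> ball i (r i))"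
    if "i \<in> I" for i
  proof -
    have "measure lebesgue (ball i (5 * r i)) = 5 ^ DIM('a) * measure lebesgue (ball i (r i))"
      using r[OF that] by (intro measure_lebesgue_ball_scale) auto
    also have "\<dots> \<le> 5 ^ DIM('a) * (measure lebesgue (U \<inter> ball i (r i)) / \<kappa>)"
      using dens[OF that] \<kappa> unfolding less_ball_density_iff[OF r[OF that]]
      by (intro mult_left_mono) (auto simp: field_simps)
    finally show ?thesis by simp
  qed
  have "measure lebesgue (\<Union>i\<in>I. ball i (5 * r i)) \<le> (\<Sum>i\<in>I. measure lebesgue (ball i (5 * r i)))"
    using I by (intro measure_UNION_le) auto
  also have "\<dots> \<le> 5 ^ DIM('a) / \<kappa> * (\<Sum>i\<in>I. measure lebesgue (U \<inter> ball i (r i)))"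
    unfolding sum_distrib_left by (rule sum_mono[OF enlarged])
  also have "(\<Sum>i\<in>I. measure lebesgue (U \<inter> ball i (r i))) = measure lebesgue (\<Union>i\<in>I. U \<inter> ball i (r i))"
  proof (rule measure_UNION'[symmetric])
    show "pairwise (\<lambda>i j. disjnt (U \<inter> ball i (r i)) (U \<inter> ball j (r j))) I"
      by (rule pairwise_mono[OF disj _ order_refl])
        (meson Int_lower2 ball_subset_cball disjnt_subset1 disjnt_subset2 order_trans)
  qed (use U I in \<open>auto intro: lmeasurable_Int_ball\<close>)
  also have "\<dots> \<le> measure lebesgue U"
    using U I fmeasurableD[OF lmeasurable_Int_ball]
    by (intro measure_mono_fmeasurable sets.finite_UN) auto
  finally show ?thesis
    using \<kappa> by (simp add: mult_left_mono divide_right_mono)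
qed

lemma maximal_inequality_ball:
  fixes U :: "'a::euclidean_space set"
  assumes U: "U \<in> lmeasurable" and \<kappa>: "0 < \<kappa>"
  obtains V where "V \<in> lmeasurable" "measure lebesgue V \<le> 5 ^ DIM('a) / \<kappa> * measure lebesgue U"
    "{x. \<exists>t\<in>{0<..T}. \<kappa> < ball_density U x t} \<subseteq> V"
proof -
  define A where "A = {x. \<exists>t\<in>{0<..T}. \<kappa> < ball_density U x t}"
  have "\<exists>r. \<forall>x\<in>A. r x \<in> {0<..T} \<and> \<kappa> < ball_density U x (r x)"
    by (intro bchoice) (auto simp: A_def)
  then obtain r where r: "\<And>x. x \<in> A \<Longrightarrow> 0 < r x \<and> r x \<le> T"
    and dens: "\<And>x. x \<in> A \<Longrightarrow> \<kappa> < ball_density U x (r x)"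
    by auto
  obtain C where C: "countable C" "C \<subseteq> A"
    and disj: "pairwise (\<lambda>i j. disjnt (cball i (r i)) (cball j (r j))) C"
    and cover: "\<And>i. i \<in> A \<Longrightarrow> \<exists>j. j \<in> C \<and> \<not> disjnt (cball i (r i)) (cball j (r j)) \<and>
                        cball i (r i) \<subseteq> ball j (5 * r j)"
    by (rule Vitali_covering_lemma_cballs_balls[of A r T "\<lambda>i. i", OF r]) blast+
  have bound: "measure lebesgue (\<Union>i\<in>I. ball i (5 * r i)) \<le> 5 ^ DIM('a) / \<kappa> * measure lebesgue U"
    if "I \<subseteq> C" "finite I" for I
    using that C(2) r dens by (intro measure_UN_enlarged_balls_le[OF U \<kappa>] pairwise_subset[OF disj]) auto
  define V where "V = (\<Union>i\<in>C. ball i (5 * r i))"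
  have "x \<in> V" if "x \<in> A" for x
    using cover[OF that] r[OF that] unfolding V_def by fastforce
  moreover have "V \<in> lmeasurable" "measure lebesgue V \<le> 5 ^ DIM('a) / \<kappa> * measure lebesgue U"
    unfolding V_def using fmeasurable_UN_bound[OF C(1) lmeasurable_ball bound]
      measure_UN_bound[OF C(1) lmeasurable_ball bound] by blast+
  ultimately show thesis
    by (intro that[of V]) (auto simp: A_def)
qed

lemma negligible_positive_upper_density:
  fixes E :: "'a::euclidean_space set"
  assumes E: "E \<in> sets lebesgue" and \<kappa>: "0 < \<kappa>"
  shows "negligible {x. x \<notin> E \<and> (\<exists>\<^sub>F t in at_right 0. \<kappa> < ball_density E x t)}" (is "negligible ?A")
  unfolding negligible_outer_le
proof (intro allI impI)
  fix e :: real assume "0 < e"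
  define \<delta> where "\<delta> = e * \<kappa> / 5 ^ DIM('a)"
  have "0 < \<delta>" using \<open>0 < e\<close> \<kappa> by (simp add: \<delta>_def)
  obtain C where C: "closed C" "C \<subseteq> E" "E - C \<in> lmeasurable" "emeasure lebesgue (E - C) < ennreal \<delta>"
    using sets_lebesgue_inner_closed[OF E \<open>0 < \<delta>\<close>] by blast
  then have small: "measure lebesgue (E - C) \<le> \<delta>"
    using \<open>0 < \<delta>\<close> by (simp add: emeasure_eq_measure2 ennreal_less_iff)
  obtain V where V: "V \<in> lmeasurable" "measure lebesgue V \<le> 5 ^ DIM('a) / \<kappa> * measure lebesgue (E - C)"
    "{x. \<exists>t\<in>{0<..1}. \<kappa> < ball_density (E - C) x t} \<subseteq> V"
    by (rule maximal_inequality_ball[OF C(3) \<kappa>])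
  have "?A \<subseteq> V"
  proof
    fix x assume x: "x \<in> ?A"
    then have "x \<in> - C" "open (- C)" using C by auto
    then obtain \<tau> where \<tau>: "0 < \<tau>" "ball x \<tau> \<subseteq> - C"
      using openE by blast
    have "\<forall>\<^sub>F t in at_right 0. 0 < t \<and> t < min \<tau> 1"
      using \<tau>(1) by (intro eventually_at_rightI[of 0 "min \<tau> 1"]) auto
    moreover have "\<exists>\<^sub>F t in at_right 0. \<kappa> < ball_density E x t" using x by blast
    ultimately have "\<exists>\<^sub>F t in at_right 0. \<kappa> < ball_density E x t \<and> 0 < t \<and> t < min \<tau> 1"
      by (rule frequently_eventually_frequently[rotated])
    then obtain t where t: "\<kappa> < ball_density E x t" "0 < t" "t < \<tau>" "t < 1"
      by (auto dest: frequently_ex)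
    have "E \<inter> ball x t = (E - C) \<inter> ball x t"
      using \<tau>(2) t(3) subset_ball[of t \<tau> x] by auto
    then have "ball_density E x t = ball_density (E - C) x t" by (simp only: ball_density_def)
    then show "x \<in> V" using t by (intro subsetD[OF V(3)]) auto
  qed
  moreover have "5 ^ DIM('a) / \<kappa> * measure lebesgue (E - C) \<le> 5 ^ DIM('a) / \<kappa> * \<delta>"
    using small \<kappa> by (intro mult_left_mono) auto
  moreover have "5 ^ DIM('a) / \<kappa> * \<delta> = e" using \<kappa> by (simp add: \<delta>_def)
  ultimately show "\<exists>T. ?A \<subseteq> T \<and> T \<in> lmeasurable \<and> measure lebesgue T \<le> e"
    using V by (intro exI[of _ V]) auto
qed

lemma AE_ball_density_tendsto_0:
  fixes E :: "'a::euclidean_space set"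
  assumes E: "E \<in> sets lebesgue"
  shows "AE x in lebesgue. x \<notin> E \<longrightarrow> (ball_density E x \<longlongrightarrow> 0) (at_right 0)"
proof -
  have "AE x in lebesgue. \<forall>k. x \<notin> E \<longrightarrow>
      (\<forall>\<^sub>F t in at_right 0. ball_density E x t \<le> inverse (real (Suc k)))"
    unfolding AE_all_countable
  proof
    fix k
    have "{x. x \<notin> E \<and> (\<exists>\<^sub>F t in at_right 0. inverse (real (Suc k)) < ball_density E x t)}
        \<in> null_sets lebesgue"
      using negligible_positive_upper_density[OF E, of "inverse (real (Suc k))"]
      by (simp add: negligible_iff_null_sets)
    then show "AE x in lebesgue. x \<notin> E \<longrightarrow>
        (\<forall>\<^sub>F t in at_right 0. ball_density E x t \<le> inverse (real (Suc k)))"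
      by (rule AE_I') (auto simp: not_eventually not_le)
  qed
  then show ?thesis
  proof eventually_elim
    case (elim x)
    show ?case
    proof (intro impI order_tendstoI)
      fix a :: real assume "0 < a" "x \<notin> E"
      obtain k where k: "inverse (real (Suc k)) < a" using reals_Archimedean[OF \<open>0 < a\<close>] by blast
      have "\<forall>\<^sub>F t in at_right 0. ball_density E x t \<le> inverse (real (Suc k))"
        using elim \<open>x \<notin> E\<close> by blast
      then show "\<forall>\<^sub>F t in at_right 0. ball_density E x t < a"
        by eventually_elim (use k in linarith)
    qed (use ball_density_nonneg[of E x] in \<open>auto intro: always_eventually less_le_trans\<close>)
  qed
qed

lemma lebesgue_density_theorem:
  fixes E :: "'a::euclidean_space set"
  assumes E: "E \<in> sets lebesgue"
  shows "AE x in lebesgue. (ball_density E x \<longlongrightarrow> indicator E x) (at_right 0)"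
proof -
  have E': "- E \<in> sets lebesgue" using E by (simp add: Compl_in_sets_lebesgue)
  from AE_ball_density_tendsto_0[OF E] AE_ball_density_tendsto_0[OF E'] show ?thesis
  proof eventually_elim
    case (elim x)
    show ?case
    proof (cases "x \<in> E")
      case True
      then show ?thesis using elim(2) tendsto_ball_density_Compl[OF E', of x 0] by simp
    qed (use elim(1) in simp)
  qed
qed

subsection \<open>The region outside two tangent balls\<close>

lemma card_mult_measure_le_of_disjoint_translates:
  fixes S T :: "'a::euclidean_space set"
  assumes S: "S \<in> lmeasurable" and T: "T \<in> lmeasurable" and I: "finite I"
    and disj: "pairwise (\<lambda>i j. disjnt ((+) (a i) ` S) ((+) (a j) ` S)) I"
    and sub: "\<And>i. i \<in> I \<Longrightarrow> (+) (a i) ` S \<subseteq> T"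
  shows "real (card I) * measure lebesgue S \<le> measure lebesgue T"
proof -
  have translate: "(+) (a i) ` S \<in> lmeasurable" for i using S by (rule measurable_translation)
  have "real (card I) * measure lebesgue S = (\<Sum>i\<in>I. measure lebesgue ((+) (a i) ` S))"
    by (simp add: measure_translation)
  also have "\<dots> = measure lebesgue (\<Union>i\<in>I. (+) (a i) ` S)"
    using I disj translate by (intro measure_UNION'[symmetric])
  also have "\<dots> \<le> measure lebesgue T"
    using T I sub translate by (intro measure_mono_fmeasurable sets.finite_UN) auto
  finally show ?thesis .
qed

definition slab :: "'a::euclidean_space \<Rightarrow> 'a \<Rightarrow> real \<Rightarrow> 'a set" where
  "slab x e h = {y. \<bar>(y - x) \<bullet> e\<bar> \<le> h}"

lemma slab_sets_lebesgue: "slab x e h \<in> sets lebesgue"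
proof -
  have "slab x e h \<in> sets borel" unfolding slab_def by measurable
  then show ?thesis by simp
qed

lemma disjnt_slab_translates:
  assumes e: "norm e = 1" and h: "0 < h" and ij: "i \<noteq> (j::nat)" and S: "S \<subseteq> slab x e h"
  shows "disjnt ((+) ((3 * h * real i) *\<^sub>R e) ` S) ((+) ((3 * h * real j) *\<^sub>R e) ` S)"
proof -
  have "e \<bullet> e = 1" using e by (simp add: norm_eq_1)
  then have near: "\<bar>(y - x) \<bullet> e - 3 * h * real k\<bar> \<le> h" if "y \<in> (+) ((3 * h * real k) *\<^sub>R e) ` S" for y k
    using that S by (auto simp: slab_def inner_add_left inner_diff_left)
  have False if y: "y \<in> (+) ((3 * h * real i) *\<^sub>R e) ` S" "y \<in> (+) ((3 * h * real j) *\<^sub>R e) ` S" for y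
  proof -
    have "\<bar>3 * h * real i - 3 * h * real j\<bar> \<le> 2 * h" using near[OF y(1)] near[OF y(2)] by linarith
    moreover have "\<bar>3 * h * real i - 3 * h * real j\<bar> = h * (3 * \<bar>real i - real j\<bar>)"
      using h by (simp add: abs_mult mult.assoc flip: right_diff_distrib)
    ultimately have "h * (3 * \<bar>real i - real j\<bar>) \<le> h * 2" by simp
    then have "3 * \<bar>real i - real j\<bar> \<le> 2" using h by simp
    moreover have "1 \<le> \<bar>real i - real j\<bar>" using ij by (cases i j rule: linorder_cases) auto
    ultimately show False by simp
  qed
  then show ?thesis by (auto simp: disjnt_def)
qed

text \<open>Translating the slab in steps of \<open>3h\<close> packs about \<open>t / 2h\<close> disjoint copies of it
  into \<open>B\<^bsub>3t\<^esub>(x)\<close>; this avoids rotating the slab into a box.\<close>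

lemma measure_slab_Int_ball_le:
  fixes x :: "'a::euclidean_space"
  assumes e: "norm e = 1" and h: "0 < h" and t: "0 < t"
  shows "measure lebesgue (slab x e h \<inter> ball x t) \<le> 2 * h / t * measure lebesgue (ball x (3 * t))"
proof -
  define S where "S = slab x e h \<inter> ball x t"
  define n where "n = nat \<lceil>t / (2 * h)\<rceil>"
  have sub: "(+) ((3 * h * real k) *\<^sub>R e) ` S \<subseteq> ball x (3 * t)" if "k \<in> {..<n}" for k
  proof
    fix y assume "y \<in> (+) ((3 * h * real k) *\<^sub>R e) ` S"
    then obtain v where v: "v \<in> ball x t" "y = (3 * h * real k) *\<^sub>R e + v" by (auto simp: S_def)
    have "real k < t / (2 * h)" using that by (simp add: n_def zless_nat_eq_int_zless less_ceiling_iff)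
    then have "3 * h * real k \<le> 2 * t" using h t by (simp add: field_simps)
    moreover have "norm ((v - x) + (3 * h * real k) *\<^sub>R e) \<le> norm (v - x) + 3 * h * real k"
      using norm_triangle_ineq[of "v - x" "(3 * h * real k) *\<^sub>R e"] e h by simp
    moreover have "norm (v - x) < t" using v(1) by (simp add: dist_norm norm_minus_commute)
    ultimately have "norm ((v - x) + (3 * h * real k) *\<^sub>R e) < 3 * t" by linarith
    then show "y \<in> ball x (3 * t)"
      by (simp add: v(2) dist_norm norm_minus_commute[of x] algebra_simps)
  qed
  have "t / (2 * h) * measure lebesgue S \<le> real n * measure lebesgue S"
    unfolding n_def by (intro mult_right_mono) (auto intro: real_nat_ceiling_ge)
  also have "\<dots> = real (card {..<n}) * measure lebesgue S" by simp
  also have "\<dots> \<le> measure lebesgue (ball x (3 * t))"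
  proof (rule card_mult_measure_le_of_disjoint_translates[where a = "\<lambda>k. (3 * h * real k) *\<^sub>R e"])
    show "S \<in> lmeasurable" unfolding S_def by (rule lmeasurable_Int_ball[OF slab_sets_lebesgue])
    show "pairwise (\<lambda>i j. disjnt ((+) ((3 * h * real i) *\<^sub>R e) ` S)
        ((+) ((3 * h * real j) *\<^sub>R e) ` S)) {..<n}"
      unfolding pairwise_def S_def using disjnt_slab_translates[OF e h _ Int_lower1] by blast
  qed (use sub in auto)
  finally show ?thesis using h t by (simp add: S_def field_simps del: measure_completion)
qed

definition outside_tangent_balls :: "'a::euclidean_space \<Rightarrow> 'a \<Rightarrow> 'a set" where
  "outside_tangent_balls z x = - (ball z (dist z x) \<union> ball (2 *\<^sub>R x - z) (dist z x))"

lemma outside_tangent_balls_sets_lebesgue: "outside_tangent_balls z x \<in> sets lebesgue"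
  by (simp add: outside_tangent_balls_def closed_Compl open_Un borel_closed)

lemma outside_tangent_balls_subset_slab:
  fixes x z :: "'a::euclidean_space"
  assumes "x \<noteq> z" "0 < t"
  shows "outside_tangent_balls z x \<inter> ball x t \<subseteq> slab x ((z - x) /\<^sub>R dist z x) (t\<^sup>2 / (2 * dist z x))"
proof
  fix y assume y: "y \<in> outside_tangent_balls z x \<inter> ball x t"
  define u w where "u = y - x" and "w = z - x"
  have "norm w \<le> norm (w - u)" "norm w \<le> norm (- (w + u))"
    using y by (auto simp: outside_tangent_balls_def u_def w_def dist_norm scaleR_2 algebra_simps)
  then have "w \<bullet> w \<le> (w - u) \<bullet> (w - u)" "w \<bullet> w \<le> (w + u) \<bullet> (w + u)"
    by (simp_all only: norm_minus_cancel norm_le)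
  moreover have "u \<bullet> u \<le> t\<^sup>2"
    using y assms(2) by (simp add: u_def dist_norm norm_minus_commute power_mono flip: power2_norm_eq_inner)
  ultimately have "\<bar>u \<bullet> w\<bar> \<le> t\<^sup>2 / 2"
    by (simp add: inner_diff_left inner_diff_right inner_add_left inner_add_right inner_commute)
  moreover have "0 < norm w" using assms(1) by (simp add: w_def)
  ultimately have "\<bar>u \<bullet> (w /\<^sub>R norm w)\<bar> \<le> t\<^sup>2 / (2 * norm w)"
    by (simp add: abs_mult field_simps)
  then show "y \<in> slab x ((z - x) /\<^sub>R dist z x) (t\<^sup>2 / (2 * dist z x))"
    by (simp add: slab_def u_def w_def dist_norm)
qed

lemma measure_outside_tangent_balls_le:
  fixes x z :: "'a::euclidean_space"
  assumes z: "x \<noteq> z" and t: "0 < t"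
  shows "measure lebesgue (outside_tangent_balls z x \<inter> ball x t)
    \<le> 3 ^ DIM('a) * unit_ball_vol (real DIM('a)) / dist z x * t ^ (DIM('a) + 1)"
proof -
  define e h where "e = (z - x) /\<^sub>R dist z x" and "h = t\<^sup>2 / (2 * dist z x)"
  have "norm e = 1" "0 < h" using z t by (simp_all add: e_def h_def dist_norm)
  have "measure lebesgue (outside_tangent_balls z x \<inter> ball x t) \<le> measure lebesgue (slab x e h \<inter> ball x t)"
    using outside_tangent_balls_subset_slab[OF z t] outside_tangent_balls_sets_lebesgue[of z x]
    unfolding e_def h_def by (intro measure_mono_fmeasurable lmeasurable_Int_ball slab_sets_lebesgue) auto
  also have "\<dots> \<le> 2 * h / t * measure lebesgue (ball x (3 * t))"
    by (rule measure_slab_Int_ball_le[OF \<open>norm e = 1\<close> \<open>0 < h\<close> t])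
  also have "\<dots> = 3 ^ DIM('a) * unit_ball_vol (real DIM('a)) / dist z x * t ^ (DIM('a) + 1)"
    using t z by (simp add: measure_lebesgue_ball h_def field_simps power2_eq_square power_mult_distrib
        del: measure_completion)
  finally show ?thesis .
qed

subsection \<open>Integrals of radial powers\<close>

lemma nn_set_integral_le_suminf:
  fixes f :: "'a \<Rightarrow> ennreal"
  assumes B[measurable]: "\<And>k::nat. B k \<in> sets M" and cover: "\<And>y. y \<in> A \<Longrightarrow> \<exists>k. y \<in> B k \<and> f y \<le> c k"
  shows "(\<integral>\<^sup>+y\<in>A. f y \<partial>M) \<le> (\<Sum>k. c k * emeasure M (B k))"
proof -
  have "(\<integral>\<^sup>+y\<in>A. f y \<partial>M) \<le> (\<integral>\<^sup>+y. (\<Sum>k. c k * indicator (B k) y) \<partial>M)"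
  proof (rule nn_integral_mono)
    fix y
    show "f y * indicator A y \<le> (\<Sum>k. c k * indicator (B k) y)"
    proof (cases "y \<in> A")
      case True
      then obtain k where "y \<in> B k" "f y \<le> c k" using cover by blast
      then have "f y * indicator A y \<le> (\<Sum>i\<in>{k}. c i * indicator (B i) y)"
        using True by simp
      also have "\<dots> \<le> (\<Sum>k. c k * indicator (B k) y)"
        by (rule sum_le_suminf) auto
      finally show ?thesis .
    qed simp
  qed
  also have "\<dots> = (\<Sum>k. \<integral>\<^sup>+y. c k * indicator (B k) y \<partial>M)"
    using B by (intro nn_integral_suminf) measurable
  also have "\<dots> = (\<Sum>k. c k * emeasure M (B k))"
    using B by (simp add: nn_integral_cmult_indicator)
  finally show ?thesis .
qed

lemma set_integral_le_sums:
  fixes f :: "'a \<Rightarrow> real"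
  assumes A: "A \<in> sets M" and f: "f \<in> borel_measurable M" "\<And>y. 0 \<le> f y"
    and B: "\<And>k::nat. B k \<in> fmeasurable M" and c: "\<And>k. 0 \<le> c k"
    and cover: "\<And>y. y \<in> A \<Longrightarrow> \<exists>k. y \<in> B k \<and> f y \<le> c k"
    and b: "\<And>k. c k * measure M (B k) \<le> b k" "b sums L"
  shows "set_integrable M A f" and "(LINT y:A|M. f y) \<le> L"
proof -
  have b_nonneg: "0 \<le> b k" for k
    using b(1)[of k] c[of k] by (meson measure_nonneg mult_nonneg_nonneg order_trans)
  then have L_nonneg: "0 \<le> L" using b(2) by (metis sums_le sums_zero)
  have "(\<integral>\<^sup>+y\<in>A. ennreal (f y) \<partial>M) \<le> (\<Sum>k. ennreal (c k) * emeasure M (B k))"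
    using B c cover by (intro nn_set_integral_le_suminf) (auto simp: fmeasurable_def intro: ennreal_leI)
  also have "\<dots> = (\<Sum>k. ennreal (c k * measure M (B k)))"
    using B c by (simp add: emeasure_eq_measure2 ennreal_mult)
  also have "\<dots> \<le> (\<Sum>k. ennreal (b k))"
    using b(1) by (intro suminf_le ennreal_leI) auto
  also have "\<dots> = ennreal L"
    using b_nonneg b(2) by (simp add: suminf_ennreal2 sums_iff)
  finally have "(\<integral>\<^sup>+y\<in>A. ennreal (f y) \<partial>M) \<le> ennreal L" .
  moreover have "(\<integral>\<^sup>+y\<in>A. ennreal (f y) \<partial>M) = (\<integral>\<^sup>+y. ennreal (indicator A y *\<^sub>R f y) \<partial>M)"
    by (intro nn_integral_cong) (simp add: indicator_def)
  ultimately have le: "(\<integral>\<^sup>+y. ennreal (indicator A y *\<^sub>R f y) \<partial>M) \<le> ennreal L" by simp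
  show "(LINT y:A|M. f y) \<le> L"
    unfolding set_lebesgue_integral_def by (rule integral_real_bounded[OF L_nonneg le])
  show "set_integrable M A f"
    unfolding set_integrable_def using A f le_less_trans[OF le]
    by (intro integrableI_nonneg) auto
qed

lemma set_integral_mono_set:
  fixes f :: "'a \<Rightarrow> real"
  assumes f: "set_integrable M B f" "\<And>y. y \<in> B \<Longrightarrow> 0 \<le> f y" and A: "A \<in> sets M" "A \<subseteq> B"
  shows "(LINT y:A|M. f y) \<le> (LINT y:B|M. f y)"
  using f set_integrable_subset[OF f(1) A] A(2) unfolding set_lebesgue_integral_def set_integrable_def
  by (intro integral_mono) (auto simp: indicator_def)

lemma norm_diff_powr_measurable: "(\<lambda>y::'a::euclidean_space. norm (x - y) powr e) \<in> borel_measurable lebesgue"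
  by (rule measurable_completion) simp

text \<open>The integral is split over the annuli with inner radii \<open>a b\<^sup>k\<close> and twice as large outer radii:
  \<open>b = 2\<close> exhausts a neighbourhood of infinity and \<open>b = 1/2\<close> a neighbourhood of \<open>x\<close>.\<close>

lemma radial_integral_le_geometric:
  fixes x :: "'a::euclidean_space"
  assumes A: "A \<in> sets lebesgue" and D: "D \<in> sets lebesgue" "D \<subseteq> A"
    and e: "e \<le> 0" and a: "0 < a" and b: "0 < b" and ratio: "b powr (q + e) < 1"
    and growth: "\<And>k. measure lebesgue (A \<inter> ball x (2 * (a * b ^ k))) \<le> m * (2 * (a * b ^ k)) powr q"
    and annuli: "\<And>y. y \<in> D \<Longrightarrow> y \<noteq> x \<Longrightarrow> \<exists>k. a * b ^ k \<le> dist x y \<and> dist x y < 2 * (a * b ^ k)"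
  shows "set_integrable lebesgue D (\<lambda>y. norm (x - y) powr e)"
    and "(LINT y:D|lebesgue. norm (x - y) powr e) \<le> 2 powr q / (1 - b powr (q + e)) * m * a powr (q + e)"
proof -
  define B where "B k = A \<inter> ball x (2 * (a * b ^ k))" for k
  have cover: "\<exists>k. y \<in> B k \<and> norm (x - y) powr e \<le> (a * b ^ k) powr e" if "y \<in> D" for y
  proof (cases "y = x")
    case True
    then show ?thesis using that D a by (intro exI[of _ 0]) (auto simp: B_def)
  next
    case False
    then obtain k where "a * b ^ k \<le> dist x y" "dist x y < 2 * (a * b ^ k)" using annuli \<open>y \<in> D\<close> by blast
    then show ?thesis using that D a b e
      by (intro exI[of _ k]) (auto simp: B_def dist_norm intro!: powr_mono2')
  qed
  have summand: "(a * b ^ k) powr e * measure lebesgue (B k)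
      \<le> 2 powr q * m * a powr (q + e) * (b powr (q + e)) ^ k" for k
  proof -
    have "(a * b ^ k) powr e * measure lebesgue (B k) \<le> (a * b ^ k) powr e * (m * (2 * (a * b ^ k)) powr q)"
      unfolding B_def by (intro mult_left_mono growth) auto
    also have "\<dots> = 2 powr q * m * (a * b ^ k) powr (q + e)"
      using a b by (simp add: powr_mult powr_add mult_ac)
    also have "(a * b ^ k) powr (q + e) = a powr (q + e) * (b powr (q + e)) ^ k"
      using a b by (simp add: powr_mult powr_powr mult.commute flip: powr_realpow)
    finally show ?thesis by (simp add: mult_ac)
  qed
  have sums: "(\<lambda>k. 2 powr q * m * a powr (q + e) * (b powr (q + e)) ^ k)
      sums (2 powr q * m * a powr (q + e) * (1 / (1 - b powr (q + e))))"
    using ratio by (intro sums_mult geometric_sums) simp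
  have B: "B k \<in> lmeasurable" for k unfolding B_def by (rule lmeasurable_Int_ball[OF A])
  note bound = set_integral_le_sums[OF D(1) norm_diff_powr_measurable powr_ge_zero B powr_ge_zero
      cover summand sums]
  show "set_integrable lebesgue D (\<lambda>y. norm (x - y) powr e)" by (rule bound(1))
  show "(LINT y:D|lebesgue. norm (x - y) powr e) \<le> 2 powr q / (1 - b powr (q + e)) * m * a powr (q + e)"
    using bound(2) by (simp add: mult_ac)
qed

lemma radial_integral_tail_le:
  fixes x :: "'a::euclidean_space"
  assumes A: "A \<in> sets lebesgue" and e: "e \<le> 0" "q + e < 0" and \<sigma>: "0 < \<sigma>"
    and growth: "\<And>t. \<sigma> \<le> t \<Longrightarrow> measure lebesgue (A \<inter> ball x t) \<le> m * t powr q"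
  shows "set_integrable lebesgue (A - ball x \<sigma>) (\<lambda>y. norm (x - y) powr e)"
    and "(LINT y:A - ball x \<sigma>|lebesgue. norm (x - y) powr e)
      \<le> 2 powr q / (1 - 2 powr (q + e)) * m * \<sigma> powr (q + e)"
proof -
  have annuli: "\<exists>k. \<sigma> * 2 ^ k \<le> dist x y \<and> dist x y < 2 * (\<sigma> * 2 ^ k)" if "y \<in> A - ball x \<sigma>" for y
  proof -
    have "1 \<le> dist x y / \<sigma>" using that \<sigma> by simp
    define k where "k = nat \<lfloor>log 2 (dist x y / \<sigma>)\<rfloor>"
    have "\<lfloor>log 2 (dist x y / \<sigma>)\<rfloor> = int k" using \<open>1 \<le> dist x y / \<sigma>\<close> by (simp add: k_def)
    then have "2 powr real k \<le> dist x y / \<sigma>" "dist x y / \<sigma> < 2 powr (real k + 1)"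
      using \<open>1 \<le> dist x y / \<sigma>\<close> floor_log_eq_powr_iff[of "dist x y / \<sigma>" 2 "int k"] by simp_all
    then show ?thesis
      using \<sigma> by (intro exI[of _ k]) (simp add: powr_add powr_realpow field_simps)
  qed
  have "\<sigma> \<le> 2 * (\<sigma> * 2 ^ k)" for k
    using \<sigma> one_le_power[of "2::real" "Suc k"] by (simp add: mult.left_commute)
  note bound = radial_integral_le_geometric[OF A sets.Diff[OF A] Diff_subset e(1) \<sigma> _ _
      growth[OF this] annuli]
  show "set_integrable lebesgue (A - ball x \<sigma>) (\<lambda>y. norm (x - y) powr e)"
    using e by (intro bound(1)) (auto simp: powr_less_one)
  show "(LINT y:A - ball x \<sigma>|lebesgue. norm (x - y) powr e)
      \<le> 2 powr q / (1 - 2 powr (q + e)) * m * \<sigma> powr (q + e)"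
    using e by (intro bound(2)) (auto simp: powr_less_one)
qed

lemma radial_integral_near_le:
  fixes x :: "'a::euclidean_space"
  assumes A: "A \<in> sets lebesgue" and e: "e \<le> 0" "0 < q + e" and \<rho>: "0 < \<rho>"
    and growth: "\<And>t. 0 < t \<Longrightarrow> t \<le> \<rho> \<Longrightarrow> measure lebesgue (A \<inter> ball x t) \<le> m * t powr q"
  shows "set_integrable lebesgue (A \<inter> ball x \<rho>) (\<lambda>y. norm (x - y) powr e)"
    and "(LINT y:A \<inter> ball x \<rho>|lebesgue. norm (x - y) powr e)
      \<le> 2 powr q / (2 powr (q + e) - 1) * m * \<rho> powr (q + e)"
proof -
  have annuli: "\<exists>k. \<rho> / 2 * (1 / 2) ^ k \<le> dist x y \<and> dist x y < 2 * (\<rho> / 2 * (1 / 2) ^ k)"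
    if "y \<in> A \<inter> ball x \<rho>" "y \<noteq> x" for y
  proof -
    have y: "0 < dist x y" "1 < \<rho> / dist x y" using that by auto
    define k where "k = nat (\<lceil>log 2 (\<rho> / dist x y)\<rceil> - 1)"
    have "\<lceil>log 2 (\<rho> / dist x y)\<rceil> = int k + 1" using y(2) by (simp add: k_def)
    then have "2 powr real k < \<rho> / dist x y" "\<rho> / dist x y \<le> 2 powr (real k + 1)"
      using y(2) ceiling_log_eq_powr_iff[of "\<rho> / dist x y" 2 k] by (simp_all add: add.commute)
    then show ?thesis
      using y(1) by (intro exI[of _ k]) (simp add: powr_add powr_realpow field_simps)
  qed
  have growth_dyadic: "measure lebesgue (A \<inter> ball x (2 * (\<rho> / 2 * (1 / 2) ^ k)))
      \<le> m * (2 * (\<rho> / 2 * (1 / 2) ^ k)) powr q" for k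
    using \<rho> by (intro growth) (auto simp: field_simps)
  have ratio: "(1 / 2 :: real) powr (q + e) < 1" using e by (simp add: powr_divide)
  have half: "0 < \<rho> / 2" using \<rho> by simp
  note bound = radial_integral_le_geometric[OF A _ Int_lower1 e(1) half _ ratio growth_dyadic annuli]
  show "set_integrable lebesgue (A \<inter> ball x \<rho>) (\<lambda>y. norm (x - y) powr e)"
    using A by (intro bound(1)) auto
  have "(LINT y:A \<inter> ball x \<rho>|lebesgue. norm (x - y) powr e)
      \<le> 2 powr q / (1 - (1 / 2) powr (q + e)) * m * (\<rho> / 2) powr (q + e)"
    using A by (intro bound(2)) auto
  also have "\<dots> = 2 powr q / (2 powr (q + e) - 1) * m * \<rho> powr (q + e)"
    using ratio \<rho> by (simp add: powr_divide field_simps)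
  finally show "(LINT y:A \<inter> ball x \<rho>|lebesgue. norm (x - y) powr e)
      \<le> 2 powr q / (2 powr (q + e) - 1) * m * \<rho> powr (q + e)" .
qed

lemma measure_shell_ge:
  fixes x :: "'a::euclidean_space"
  assumes "0 \<le> \<sigma>"
  shows "unit_ball_vol (real DIM('a)) * \<sigma> ^ DIM('a) \<le> measure lebesgue (ball x (2 * \<sigma>) - ball x \<sigma>)"
proof -
  have "(2::real) ^ 1 \<le> 2 ^ DIM('a)" by (intro power_increasing) (auto simp: Suc_leI)
  then have "unit_ball_vol (real DIM('a)) * \<sigma> ^ DIM('a) * 1
      \<le> unit_ball_vol (real DIM('a)) * \<sigma> ^ DIM('a) * (2 ^ DIM('a) - 1)"
    using assms by (intro mult_left_mono) auto
  also have "\<dots> = measure lebesgue (ball x (2 * \<sigma>)) - measure lebesgue (ball x \<sigma>)"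
    using assms by (simp add: measure_lebesgue_ball power_mult_distrib algebra_simps del: measure_completion)
  also have "\<dots> = measure lebesgue (ball x (2 * \<sigma>) - ball x \<sigma>)"
    using assms by (intro measurable_measure_Diff[symmetric]) (auto intro: subset_ball)
  finally show ?thesis by simp
qed

lemma radial_integral_tail_ge:
  fixes x :: "'a::euclidean_space"
  assumes e: "e \<le> 0" "real DIM('a) + e < 0" and \<sigma>: "0 < \<sigma>"
  shows "2 powr e * unit_ball_vol (real DIM('a)) * \<sigma> powr (real DIM('a) + e)
    \<le> (LINT y:UNIV - ball x \<sigma>|lebesgue. norm (x - y) powr e)"
proof -
  let ?S = "ball x (2 * \<sigma>) - ball x \<sigma>"
  have int: "set_integrable lebesgue (UNIV - ball x \<sigma>) (\<lambda>y. norm (x - y) powr e)"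
    using e \<sigma> by (intro radial_integral_tail_le[where q = "real DIM('a)" and m = "unit_ball_vol (real DIM('a))"])
      (auto simp: measure_lebesgue_ball powr_realpow simp del: measure_completion)
  have S: "?S \<in> lmeasurable" by (intro fmeasurable.Diff) auto
  have "2 powr e * unit_ball_vol (real DIM('a)) * \<sigma> powr (real DIM('a) + e)
      = (2 * \<sigma>) powr e * (unit_ball_vol (real DIM('a)) * \<sigma> ^ DIM('a))"
    using \<sigma> by (simp add: powr_mult powr_add powr_realpow)
  also have "\<dots> \<le> (2 * \<sigma>) powr e * measure lebesgue ?S"
    using measure_shell_ge[of \<sigma> x] \<sigma> by (intro mult_left_mono) auto
  also have "\<dots> = (LINT y:?S|lebesgue. (2 * \<sigma>) powr e)"
    using S by (simp add: set_integral_const fmeasurable_def less_top)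
  also have "\<dots> \<le> (LINT y:?S|lebesgue. norm (x - y) powr e)"
  proof (rule set_integral_mono)
    show "set_integrable lebesgue ?S (\<lambda>y. (2 * \<sigma>) powr e)"
      using S unfolding set_integrable_def by (auto simp: fmeasurable_def)
    show "set_integrable lebesgue ?S (\<lambda>y. norm (x - y) powr e)"
      by (rule set_integrable_subset[OF int]) auto
    show "(2 * \<sigma>) powr e \<le> norm (x - y) powr e" if "y \<in> ?S" for y
      using that \<sigma> e by (intro powr_mono2') (auto simp: dist_norm)
  qed
  also have "\<dots> \<le> (LINT y:UNIV - ball x \<sigma>|lebesgue. norm (x - y) powr e)"
    by (rule set_integral_mono_set[OF int]) auto
  finally show ?thesis .
qed

subsection \<open>The fractional kernel\<close>

definition frac_kernel :: "real \<Rightarrow> 'a::euclidean_space \<Rightarrow> real" where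
  "frac_kernel s u = norm u powr (- real DIM('a) - s)"

definition tail_upper :: "nat \<Rightarrow> real \<Rightarrow> real" where
  "tail_upper d s = 2 ^ d / (1 - 2 powr (- s)) * unit_ball_vol (real d)"

definition tail_lower :: "nat \<Rightarrow> real \<Rightarrow> real" where
  "tail_lower d s = 2 powr (- real d - s) * unit_ball_vol (real d)"

definition contact_upper :: "nat \<Rightarrow> real \<Rightarrow> real" where
  "contact_upper d s = 2 ^ (d + 1) / (2 powr (1 - s) - 1) * (3 ^ d * unit_ball_vol (real d))"

definition thin_contact_coeff :: "nat \<Rightarrow> real \<Rightarrow> real \<Rightarrow> real \<Rightarrow> real \<Rightarrow> real \<Rightarrow> real" where
  "thin_contact_coeff d s lam Lam \<theta> \<eta> = lam * tail_lower d s
    - 2 * Lam * tail_upper d s * ((1 + 1 / \<theta>) ^ d * \<eta>) - Lam * contact_upper d s * \<theta>"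

lemma tail_upper_pos: "0 < s \<Longrightarrow> 0 < tail_upper d s"
  by (simp add: tail_upper_def powr_less_one)

lemma tail_lower_pos: "0 < tail_lower d s"
  by (simp add: tail_lower_def)

lemma frac_kernel_nonneg: "0 \<le> frac_kernel s u"
  by (simp add: frac_kernel_def)

lemma frac_kernel_tail_le:
  fixes x :: "'a::euclidean_space"
  assumes A: "A \<in> sets lebesgue" and s: "0 < s" and \<sigma>: "0 < \<sigma>"
    and dens: "\<And>t. \<sigma> \<le> t \<Longrightarrow> ball_density A x t \<le> \<kappa>"
  shows "set_integrable lebesgue (A - ball x \<sigma>) (\<lambda>y. frac_kernel s (x - y))"
    and "(LINT y:A - ball x \<sigma>|lebesgue. frac_kernel s (x - y)) \<le> tail_upper DIM('a) s * \<kappa> * \<sigma> powr (- s)"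
proof -
  have growth: "measure lebesgue (A \<inter> ball x t) \<le> \<kappa> * unit_ball_vol (real DIM('a)) * t powr real DIM('a)"
    if "\<sigma> \<le> t" for t
    using that \<sigma> dens[OF that] by (simp add: measure_Int_ball_eq powr_realpow mult_right_mono mult.assoc)
  have e: "- real DIM('a) - s \<le> 0" "real DIM('a) + (- real DIM('a) - s) < 0" using s by simp_all
  note bound = radial_integral_tail_le[OF A e \<sigma> growth]
  show "set_integrable lebesgue (A - ball x \<sigma>) (\<lambda>y. frac_kernel s (x - y))"
    unfolding frac_kernel_def by (rule bound(1))
  show "(LINT y:A - ball x \<sigma>|lebesgue. frac_kernel s (x - y)) \<le> tail_upper DIM('a) s * \<kappa> * \<sigma> powr (- s)"
    using bound(2) by (simp add: frac_kernel_def tail_upper_def powr_realpow mult_ac)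
qed

lemma set_integrable_frac_kernel:
  fixes x :: "'a::euclidean_space"
  assumes "0 < s" "0 < \<sigma>" "D \<in> sets lebesgue" "D \<inter> ball x \<sigma> = {}"
  shows "set_integrable lebesgue D (\<lambda>y. frac_kernel s (x - y))"
proof (rule set_integrable_subset)
  show "set_integrable lebesgue (UNIV - ball x \<sigma>) (\<lambda>y. frac_kernel s (x - y))"
    using assms ball_density_UNIV[of _ x] by (intro frac_kernel_tail_le(1)[where \<kappa> = 1]) auto
qed (use assms in auto)

lemma frac_kernel_tail_ge:
  fixes x :: "'a::euclidean_space"
  assumes "0 < s" "0 < \<sigma>"
  shows "tail_lower DIM('a) s * \<sigma> powr (- s) \<le> (LINT y:UNIV - ball x \<sigma>|lebesgue. frac_kernel s (x - y))"
  using radial_integral_tail_ge[of "- real DIM('a) - s" \<sigma> x] assms by (simp add: frac_kernel_def tail_lower_def)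

lemma frac_kernel_tail_le_of_small_density:
  fixes x :: "'a::euclidean_space"
  assumes A: "A \<in> sets lebesgue" and s: "0 < s" and \<sigma>: "0 < \<sigma>" "\<sigma> \<le> \<tau>"
    and dens: "\<And>t. \<sigma> \<le> t \<Longrightarrow> t \<le> \<tau> \<Longrightarrow> ball_density A x t \<le> \<kappa>"
  shows "(LINT y:A - ball x \<sigma>|lebesgue. frac_kernel s (x - y))
    \<le> tail_upper DIM('a) s * (\<kappa> * \<sigma> powr (- s) + \<tau> powr (- s))"
proof -
  let ?w = "\<lambda>y. frac_kernel s (x - y)" and ?N = "A \<inter> ball x \<tau>"
  have N: "?N \<in> sets lebesgue" using A by auto
  have near: "ball_density ?N x t \<le> \<kappa>" if "\<sigma> \<le> t" for t
    by (rule ball_density_Int_ball_le[OF \<sigma> dens that])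
  have far: "ball_density UNIV x t \<le> 1" if "\<tau> \<le> t" for t
    using that \<sigma> by (simp add: ball_density_UNIV)
  have \<tau>: "0 < \<tau>" and U: "(UNIV::'a set) \<in> sets lebesgue" using \<sigma> by auto
  note near_int = frac_kernel_tail_le[OF N s \<sigma>(1) near] and far_int = frac_kernel_tail_le[OF U s \<tau> far]
  have "(LINT y:A - ball x \<sigma>|lebesgue. ?w y) = (LINT y:(?N - ball x \<sigma>) \<union> (A - ball x \<tau>)|lebesgue. ?w y)"
    using \<sigma> subset_ball[of \<sigma> \<tau> x] by (intro arg_cong[where f = "\<lambda>D. LINT y:D|lebesgue. ?w y"]) auto
  also have "\<dots> = (LINT y:?N - ball x \<sigma>|lebesgue. ?w y) + (LINT y:A - ball x \<tau>|lebesgue. ?w y)"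
    using A s \<tau> by (intro set_integral_Un near_int(1) set_integrable_frac_kernel[of s \<tau>]) auto
  also have "(LINT y:A - ball x \<tau>|lebesgue. ?w y) \<le> (LINT y:UNIV - ball x \<tau>|lebesgue. ?w y)"
    using A far_int(1) by (intro set_integral_mono_set frac_kernel_nonneg) auto
  finally show ?thesis using near_int(2) far_int(2) by (simp add: algebra_simps)
qed

lemma frac_kernel_contact_le:
  fixes x z :: "'a::euclidean_space"
  assumes s: "0 < s" "s < 1" and "x \<noteq> z" "0 < \<rho>"
  shows "set_integrable lebesgue (outside_tangent_balls z x \<inter> ball x \<rho>) (\<lambda>y. frac_kernel s (x - y))"
    and "(LINT y:outside_tangent_balls z x \<inter> ball x \<rho>|lebesgue. frac_kernel s (x - y))
      \<le> contact_upper DIM('a) s / dist z x * \<rho> powr (1 - s)"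
proof -
  have growth: "measure lebesgue (outside_tangent_balls z x \<inter> ball x t)
      \<le> 3 ^ DIM('a) * unit_ball_vol (real DIM('a)) / dist z x * t powr (real DIM('a) + 1)" if "0 < t" for t
    using measure_outside_tangent_balls_le[OF \<open>x \<noteq> z\<close> that] that by (simp add: powr_add powr_realpow mult_ac)
  have e: "- real DIM('a) - s \<le> 0" "0 < real DIM('a) + 1 + (- real DIM('a) - s)" using s by simp_all
  note bound = radial_integral_near_le[OF outside_tangent_balls_sets_lebesgue e \<open>0 < \<rho>\<close> growth]
  show "set_integrable lebesgue (outside_tangent_balls z x \<inter> ball x \<rho>) (\<lambda>y. frac_kernel s (x - y))"
    unfolding frac_kernel_def by (rule bound(1))
  show "(LINT y:outside_tangent_balls z x \<inter> ball x \<rho>|lebesgue. frac_kernel s (x - y))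
      \<le> contact_upper DIM('a) s / dist z x * \<rho> powr (1 - s)"
    using bound(2) by (simp add: frac_kernel_def contact_upper_def powr_add powr_realpow mult_ac)
qed

subsection \<open>Truncated curvature integrals\<close>

lemma
  fixes c :: "'a::euclidean_space"
  shows measurable_lebesgue_reflect: "(\<lambda>y. c - y) \<in> lebesgue \<rightarrow>\<^sub>M lebesgue"
    and distr_lebesgue_reflect: "distr lebesgue lebesgue (\<lambda>y. c - y) = lebesgue"
proof -
  have eq: "(\<lambda>y::'a. c + (\<Sum>j\<in>Basis. ((-1) * (y \<bullet> j)) *\<^sub>R j)) = (\<lambda>y. c - y)"
    by (simp add: sum_negf euclidean_representation)
  show "(\<lambda>y. c - y) \<in> lebesgue \<rightarrow>\<^sub>M lebesgue"
    using lebesgue_affine_measurable[of "\<lambda>_. -1" c] unfolding eq by simp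
  show "distr lebesgue lebesgue (\<lambda>y. c - y) = lebesgue"
    using lebesgue_affine_euclidean[of "\<lambda>_. -1" c] unfolding eq by (simp add: density_1)
qed

lemma tchi_measurable:
  assumes "E \<in> sets M"
  shows "tchi E \<in> borel_measurable M"
proof -
  have "tchi E = (\<lambda>y. 1 - 2 * indicator E y)"
    by (auto simp: tchi_def indicator_def)
  then show ?thesis using assms by simp
qed

lemma nmc_trunc_Compl: "nmc_trunc K (- E) x \<epsilon> = - nmc_trunc K E x \<epsilon>"
proof -
  have "(\<lambda>y. indicator (UNIV - ball x \<epsilon>) y *\<^sub>R (tchi (- E) y * K (x - y)))
      = (\<lambda>y. - (indicator (UNIV - ball x \<epsilon>) y *\<^sub>R (tchi E y * K (x - y))))"
    by (auto simp: tchi_def)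
  then show ?thesis by (simp add: nmc_trunc_def set_lebesgue_integral_def)
qed

lemma tchi_add_tchi_reflect_nonneg:
  assumes "E \<inter> ball z (dist z x) = {}" "y \<notin> outside_tangent_balls z x"
  shows "0 \<le> tchi E y + tchi E (2 *\<^sub>R x - y)"
proof -
  have "dist (2 *\<^sub>R x - z) y = dist z (2 *\<^sub>R x - y)"
    by (simp add: dist_norm norm_minus_commute algebra_simps)
  then have "y \<notin> E \<or> 2 *\<^sub>R x - y \<notin> E" using assms by (auto simp: outside_tangent_balls_def)
  then show ?thesis by (auto simp: tchi_def)
qed

lemma tendsto_ereal_almost_antimono:
  fixes f \<eta> :: "real \<Rightarrow> real"
  assumes f: "\<And>\<epsilon> \<sigma>. 0 < \<epsilon> \<Longrightarrow> \<epsilon> \<le> \<sigma> \<Longrightarrow> f \<sigma> - \<eta> \<sigma> \<le> f \<epsilon>"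
    and \<eta>: "(\<eta> \<longlongrightarrow> 0) (at_right 0)"
  obtains l where "((\<lambda>\<epsilon>. ereal (f \<epsilon>)) \<longlongrightarrow> l) (at_right 0)" "\<forall>\<sigma>>0. ereal (f \<sigma> - \<eta> \<sigma>) \<le> l"
proof -
  define l where "l = (SUP \<sigma>\<in>{0<..}. ereal (f \<sigma> - \<eta> \<sigma>))"
  have upper: "ereal (f \<sigma> - \<eta> \<sigma>) \<le> l" if "0 < \<sigma>" for \<sigma>
    unfolding l_def using that by (intro SUP_upper) auto
  have "((\<lambda>\<epsilon>. ereal (f \<epsilon>)) \<longlongrightarrow> l) (at_right 0)"
  proof (rule order_tendstoI)
    fix a assume "a < l"
    then obtain \<sigma> where \<sigma>: "0 < \<sigma>" "a < ereal (f \<sigma> - \<eta> \<sigma>)"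
      unfolding l_def less_SUP_iff by auto
    then have "a < ereal (f \<epsilon>)" if "0 < \<epsilon>" "\<epsilon> < \<sigma>" for \<epsilon>
      using f[of \<epsilon> \<sigma>] that by (meson ereal_less_eq(3) less_imp_le less_le_trans)
    then show "\<forall>\<^sub>F \<epsilon> in at_right 0. a < ereal (f \<epsilon>)"
      using \<sigma>(1) by (intro eventually_at_rightI[of 0 \<sigma>]) auto
  next
    fix a assume "l < a"
    have "((\<lambda>\<epsilon>. l + ereal (\<eta> \<epsilon>)) \<longlongrightarrow> l + ereal 0) (at_right 0)"
      using \<eta> by (intro tendsto_add_ereal_general1 tendsto_const) auto
    then have "\<forall>\<^sub>F \<epsilon> in at_right 0. l + ereal (\<eta> \<epsilon>) < a"
      using \<open>l < a\<close> by (intro order_tendstoD(2)) auto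
    then show "\<forall>\<^sub>F \<epsilon> in at_right 0. ereal (f \<epsilon>) < a"
      using eventually_at_right_less[of 0]
    proof eventually_elim
      case (elim \<epsilon>)
      have "ereal (f \<epsilon>) \<le> l + ereal (\<eta> \<epsilon>)" using upper[OF elim(2)] by (cases l) auto
      then show ?case using elim(1) by (rule le_less_trans)
    qed
  qed
  then show thesis using upper by (intro that) auto
qed

locale elliptic_kernel =
  fixes K :: "'a::euclidean_space \<Rightarrow> real" and s lam Lam :: real
  assumes s: "0 < s" "s < 1" and lam: "0 < lam" "lam \<le> Lam"
    and K_measurable: "K \<in> borel_measurable lebesgue"
    and K_lower: "\<And>u. u \<noteq> 0 \<Longrightarrow> lam * frac_kernel s u \<le> K u"
    and K_upper: "\<And>u. u \<noteq> 0 \<Longrightarrow> K u \<le> Lam * frac_kernel s u"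
    and K_even: "\<And>u. u \<noteq> 0 \<Longrightarrow> K (- u) = K u"
begin

lemma K_nonneg: "u \<noteq> 0 \<Longrightarrow> 0 \<le> K u"
  using K_lower[of u] lam frac_kernel_nonneg[of s u] by (meson less_imp_le mult_nonneg_nonneg order_trans)

lemma K_diff_measurable: "(\<lambda>y. K (x - y)) \<in> borel_measurable lebesgue"
  by (rule measurable_compose[OF measurable_lebesgue_reflect K_measurable])

lemma set_integrable_mult_kernel:
  assumes \<epsilon>: "0 < \<epsilon>" and D: "D \<in> sets lebesgue" "D \<inter> ball x \<epsilon> = {}"
    and g: "g \<in> borel_measurable lebesgue" "\<And>y. \<bar>g y\<bar> \<le> C"
  shows "set_integrable lebesgue D (\<lambda>y. g y * K (x - y))"
proof (rule set_integrable_bound)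
  show "set_integrable lebesgue D (\<lambda>y. C * (Lam * frac_kernel s (x - y)))"
    by (intro set_integrable_mult_right set_integrable_frac_kernel[OF s(1) \<epsilon> D])
  show "set_borel_measurable lebesgue D (\<lambda>y. g y * K (x - y))"
    unfolding set_borel_measurable_def using D(1) g(1) K_diff_measurable[of x] by measurable
  show "AE y in lebesgue. y \<in> D \<longrightarrow> norm (g y * K (x - y)) \<le> norm (C * (Lam * frac_kernel s (x - y)))"
  proof (intro AE_I2 impI)
    fix y assume "y \<in> D"
    then have "x - y \<noteq> 0" using D(2) \<epsilon> by auto
    then have "\<bar>g y\<bar> * \<bar>K (x - y)\<bar> \<le> C * (Lam * frac_kernel s (x - y))"
      using g(2)[of y] K_upper[of "x - y"] K_nonneg[of "x - y"] by (intro mult_mono) auto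
    then show "norm (g y * K (x - y)) \<le> norm (C * (Lam * frac_kernel s (x - y)))"
      by (metis abs_ge_self abs_mult order_trans real_norm_def)
  qed
qed

lemma set_integrable_kernel:
  assumes "0 < \<epsilon>" "D \<in> sets lebesgue" "D \<inter> ball x \<epsilon> = {}"
  shows "set_integrable lebesgue D (\<lambda>y. K (x - y))"
  using set_integrable_mult_kernel[OF assms, of "\<lambda>_. 1" 1] by simp

lemma set_integrable_tchi_kernel:
  assumes "E \<in> sets lebesgue" "0 < \<epsilon>" "D \<in> sets lebesgue" "D \<inter> ball x \<epsilon> = {}"
  shows "set_integrable lebesgue D (\<lambda>y. tchi E y * K (x - y))"
  using assms by (intro set_integrable_mult_kernel[where C = 1] tchi_measurable) (auto simp: tchi_def)

lemma kernel_integral_bounds: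
  assumes \<epsilon>: "0 < \<epsilon>" and D: "D \<in> sets lebesgue" "D \<inter> ball x \<epsilon> = {}"
  shows "lam * (LINT y:D|lebesgue. frac_kernel s (x - y)) \<le> (LINT y:D|lebesgue. K (x - y))"
    and "(LINT y:D|lebesgue. K (x - y)) \<le> Lam * (LINT y:D|lebesgue. frac_kernel s (x - y))"
proof -
  have "x - y \<noteq> 0" if "y \<in> D" for y using that D(2) \<epsilon> by auto
  note K_lower[OF this] K_upper[OF this]
  moreover note set_integrable_frac_kernel[OF s(1) \<epsilon> D] set_integrable_kernel[OF \<epsilon> D]
  ultimately show "lam * (LINT y:D|lebesgue. frac_kernel s (x - y)) \<le> (LINT y:D|lebesgue. K (x - y))"
    "(LINT y:D|lebesgue. K (x - y)) \<le> Lam * (LINT y:D|lebesgue. frac_kernel s (x - y))"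
    by (simp_all add: set_integral_mono flip: set_integral_mult_right)
qed

lemma nmc_trunc_eq_kernel_integrals:
  assumes E: "E \<in> sets lebesgue" and \<epsilon>: "0 < \<epsilon>"
  shows "nmc_trunc K E x \<epsilon> = (LINT y:UNIV - ball x \<epsilon>|lebesgue. K (x - y))
    - 2 * (LINT y:E - ball x \<epsilon>|lebesgue. K (x - y))"
proof -
  let ?U = "UNIV - ball x \<epsilon>"
  have "nmc_trunc K E x \<epsilon> = (LINT y:?U|lebesgue. K (x - y) - 2 * (indicator E y * K (x - y)))"
    unfolding nmc_trunc_def by (intro set_lebesgue_integral_cong) (auto simp: tchi_def)
  also have "\<dots> = (LINT y:?U|lebesgue. K (x - y)) - 2 * (LINT y:?U|lebesgue. indicator E y * K (x - y))"
    using E \<epsilon> by (subst set_integral_diff(2))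
      (auto intro!: set_integrable_kernel set_integrable_mult_kernel[where C = 1] borel_measurable_indicator
        simp: indicator_def)
  also have "(LINT y:?U|lebesgue. indicator E y * K (x - y)) = (LINT y:E - ball x \<epsilon>|lebesgue. K (x - y))"
    unfolding set_lebesgue_integral_def by (intro Bochner_Integration.integral_cong) (auto simp: indicator_def)
  finally show ?thesis .
qed

lemma nmc_trunc_ge_of_small_density:
  assumes E: "E \<in> sets lebesgue" and \<sigma>: "0 < \<sigma>" "\<sigma> \<le> \<tau>"
    and dens: "\<And>t. \<sigma> \<le> t \<Longrightarrow> t \<le> \<tau> \<Longrightarrow> ball_density E x t \<le> \<kappa>"
  shows "(lam * tail_lower DIM('a) s - 2 * Lam * tail_upper DIM('a) s * \<kappa>) * \<sigma> powr (- s)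
      - 2 * Lam * tail_upper DIM('a) s * \<tau> powr (- s) \<le> nmc_trunc K E x \<sigma>"
proof -
  have "(LINT y:E - ball x \<sigma>|lebesgue. K (x - y))
      \<le> Lam * (LINT y:E - ball x \<sigma>|lebesgue. frac_kernel s (x - y))"
    using E by (intro kernel_integral_bounds(2)[OF \<sigma>(1)]) auto
  also have "\<dots> \<le> Lam * (tail_upper DIM('a) s * (\<kappa> * \<sigma> powr (- s) + \<tau> powr (- s)))"
    using lam by (intro mult_left_mono frac_kernel_tail_le_of_small_density[OF E s(1) \<sigma> dens]) auto
  finally have "(LINT y:E - ball x \<sigma>|lebesgue. K (x - y))
      \<le> Lam * (tail_upper DIM('a) s * (\<kappa> * \<sigma> powr (- s) + \<tau> powr (- s)))" .
  moreover have "lam * (tail_lower DIM('a) s * \<sigma> powr (- s))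
      \<le> lam * (LINT y:UNIV - ball x \<sigma>|lebesgue. frac_kernel s (x - y))"
    using lam by (intro mult_left_mono frac_kernel_tail_ge s(1) \<sigma>(1)) auto
  moreover have "lam * (LINT y:UNIV - ball x \<sigma>|lebesgue. frac_kernel s (x - y))
      \<le> (LINT y:UNIV - ball x \<sigma>|lebesgue. K (x - y))"
    by (intro kernel_integral_bounds(1)[OF \<sigma>(1)]) auto
  ultimately show ?thesis
    unfolding nmc_trunc_eq_kernel_integrals[OF E \<sigma>(1)] by (simp add: algebra_simps)
qed

subsection \<open>Curvature at density points\<close>

lemma nmc_trunc_at_top:
  assumes E: "E \<in> sets lebesgue" and dens: "(ball_density E x \<longlongrightarrow> 0) (at_right 0)"
  shows "filterlim (nmc_trunc K E x) at_top (at_right 0)"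
proof -
  define a where "a = lam * tail_lower DIM('a) s / 2"
  define c where "c = 2 * Lam * tail_upper DIM('a) s"
  have pos: "0 < a" "0 < c" using lam tail_lower_pos tail_upper_pos[OF s(1)] by (simp_all add: a_def c_def)
  have "\<forall>\<^sub>F t in at_right 0. ball_density E x t < a / c"
    using dens pos by (intro order_tendstoD(2)) auto
  then obtain \<tau>' where \<tau>': "0 < \<tau>'" "\<And>t. 0 < t \<Longrightarrow> t < \<tau>' \<Longrightarrow> ball_density E x t < a / c"
    by (auto simp: eventually_at_right_field)
  define \<tau> where "\<tau> = \<tau>' / 2"
  have \<tau>: "0 < \<tau>" "\<tau> < \<tau>'" using \<tau>'(1) by (simp_all add: \<tau>_def)
  have "a * \<epsilon> powr (- s) - c * \<tau> powr (- s) \<le> nmc_trunc K E x \<epsilon>" if "0 < \<epsilon>" "\<epsilon> \<le> \<tau>" for \<epsilon>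
  proof -
    have "ball_density E x t \<le> a / c" if "\<epsilon> \<le> t" "t \<le> \<tau>" for t
      using \<tau>'(2)[of t] that \<open>0 < \<epsilon>\<close> \<tau> by simp
    from nmc_trunc_ge_of_small_density[OF E that this]
    have "(lam * tail_lower DIM('a) s - c * (a / c)) * \<epsilon> powr (- s) - c * \<tau> powr (- s)
        \<le> nmc_trunc K E x \<epsilon>"
      by (simp only: c_def)
    moreover have "lam * tail_lower DIM('a) s - c * (a / c) = a"
      using pos(2) by (simp add: a_def)
    ultimately show ?thesis by simp
  qed
  then have "\<forall>\<^sub>F \<epsilon> in at_right 0. a * \<epsilon> powr (- s) - c * \<tau> powr (- s) \<le> nmc_trunc K E x \<epsilon>"
    using \<tau> by (intro eventually_at_rightI[of 0 \<tau>]) auto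
  moreover have "filterlim (\<lambda>\<epsilon>. a * \<epsilon> powr (- s) - c * \<tau> powr (- s)) at_top (at_right 0)"
    using pos s by real_asymp
  ultimately show ?thesis by (rule filterlim_at_top_mono[rotated])
qed

lemma nmc_trunc_at_bot:
  assumes E: "E \<in> sets lebesgue" and dens: "(ball_density E x \<longlongrightarrow> 1) (at_right 0)"
  shows "filterlim (nmc_trunc K E x) at_bot (at_right 0)"
proof -
  have "(ball_density (- E) x \<longlongrightarrow> 0) (at_right 0)"
    using tendsto_ball_density_Compl[OF E dens] by simp
  then have "filterlim (\<lambda>\<epsilon>. - nmc_trunc K E x \<epsilon>) at_top (at_right 0)"
    using nmc_trunc_at_top[of "- E" x] E by (simp add: Compl_in_sets_lebesgue nmc_trunc_Compl[abs_def])
  then show ?thesis by (simp add: filterlim_uminus_at_bot)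
qed

lemma AE_infinite_curvature_iff:
  assumes E: "E \<in> sets lebesgue"
  shows "AE x in lebesgue. x \<in> frontier E \<and> filterlim (nmc_trunc K E x) at_top (at_right 0)
    \<longleftrightarrow> x \<in> closure E - E"
  using lebesgue_density_theorem[OF E]
proof eventually_elim
  case (elim x)
  show ?case
  proof (cases "x \<in> E")
    case True
    then have "filterlim (nmc_trunc K E x) at_bot (at_right 0)"
      using elim by (intro nmc_trunc_at_bot[OF E]) simp
    then have "\<not> filterlim (nmc_trunc K E x) at_top (at_right 0)"
      using filterlim_at_top_at_bot[of "nmc_trunc K E x" "at_right 0"] by auto
    then show ?thesis using True by simp
  next
    case False
    then have "filterlim (nmc_trunc K E x) at_top (at_right 0)"
      using elim by (intro nmc_trunc_at_top[OF E]) simp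
    then show ?thesis using False interior_subset[of E] by (auto simp: frontier_def)
  qed
qed

lemma
  assumes E: "E \<in> sets lebesgue" and G: "G \<in> sets lebesgue"
  defines "S \<equiv> {x \<in> frontier E \<inter> G. ((\<lambda>\<epsilon>. ereal (nmc_trunc K E x \<epsilon>)) \<longlongrightarrow> \<infinity>) (at_right 0)}"
  shows infinite_curvature_set_measurable: "S \<in> sets lebesgue"
    and emeasure_infinite_curvature_set_pos_iff:
      "0 < emeasure lebesgue S \<longleftrightarrow> \<not> negligible ((closure E - E) \<inter> G)"
proof -
  have ae: "AE x in lebesgue. x \<in> (closure E - E) \<inter> G \<longleftrightarrow> x \<in> S"
    using AE_infinite_curvature_iff[OF E]
    by eventually_elim (auto simp: S_def tendsto_PInfty_eq_at_top)
  have "closure E \<in> sets lebesgue" by (simp add: borel_closed)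
  then have N: "(closure E - E) \<inter> G \<in> sets lebesgue" using E G by (intro sets.Int sets.Diff)
  then show S: "S \<in> sets lebesgue" by (rule completion.in_sets_AE[OF ae]) simp
  have "emeasure lebesgue S = emeasure lebesgue ((closure E - E) \<inter> G)"
    by (rule emeasure_eq_AE[OF ae N S, symmetric])
  moreover have "negligible ((closure E - E) \<inter> G) \<longleftrightarrow> emeasure lebesgue ((closure E - E) \<inter> G) = 0"
    using N by (metis negligible_iff_null_sets null_setsD1 null_setsI)
  ultimately show "0 < emeasure lebesgue S \<longleftrightarrow> \<not> negligible ((closure E - E) \<inter> G)"
    by (simp only: zero_less_iff_neq_zero)
qed

subsection \<open>Curvature at points with an exterior touching ball\<close>

lemma nmc_trunc_eq_add_annulus:
  assumes E: "E \<in> sets lebesgue" and \<epsilon>: "0 < \<epsilon>" "\<epsilon> \<le> \<sigma>"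
  shows "nmc_trunc K E x \<epsilon>
    = nmc_trunc K E x \<sigma> + (LINT y:ball x \<sigma> - ball x \<epsilon>|lebesgue. tchi E y * K (x - y))"
proof -
  have split: "UNIV - ball x \<epsilon> = (UNIV - ball x \<sigma>) \<union> (ball x \<sigma> - ball x \<epsilon>)"
    and "(UNIV - ball x \<sigma>) \<inter> ball x \<epsilon> = {}"
    using subset_ball[OF \<epsilon>(2), of x] by blast+
  then show ?thesis
    unfolding nmc_trunc_def split
    by (intro set_integral_Un set_integrable_tchi_kernel[OF E \<epsilon>(1)]) auto
qed

lemma annulus_integral_symmetrized:
  fixes x :: 'a and \<epsilon> \<sigma> :: real
  assumes E: "E \<in> sets lebesgue" and \<epsilon>: "0 < \<epsilon>"
  defines "D \<equiv> ball x \<sigma> - ball x \<epsilon>"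
  shows "2 * (LINT y:D|lebesgue. tchi E y * K (x - y))
    = (LINT y:D|lebesgue. (tchi E y + tchi E (2 *\<^sub>R x - y)) * K (x - y))"
proof -
  let ?f = "\<lambda>y. indicator D y *\<^sub>R (tchi E y * K (x - y))"
  have D: "D \<in> sets lebesgue" "D \<inter> ball x \<epsilon> = {}" by (auto simp: D_def)
  have f: "set_integrable lebesgue D (\<lambda>y. tchi E y * K (x - y))"
    using E \<epsilon> D by (rule set_integrable_tchi_kernel)
  have "(\<lambda>y. tchi E (2 *\<^sub>R x - y)) \<in> borel_measurable lebesgue"
    using measurable_lebesgue_reflect tchi_measurable[OF E] by (rule measurable_compose)
  then have f_reflect: "set_integrable lebesgue D (\<lambda>y. tchi E (2 *\<^sub>R x - y) * K (x - y))"
    using \<epsilon> D by (intro set_integrable_mult_kernel[where C = 1]) (auto simp: tchi_def)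
  have reflect: "?f (2 *\<^sub>R x - y) = indicator D y *\<^sub>R (tchi E (2 *\<^sub>R x - y) * K (x - y))" for y
  proof -
    have "2 *\<^sub>R x - y \<in> D \<longleftrightarrow> y \<in> D"
      by (simp add: D_def dist_norm scaleR_2 norm_minus_commute)
    moreover have "K (x - (2 *\<^sub>R x - y)) = K (x - y)" if "y \<in> D"
    proof -
      have "x - y \<noteq> 0" using that D(2) \<epsilon> by auto
      then show ?thesis using K_even[of "x - y"] by (simp add: scaleR_2)
    qed
    ultimately show ?thesis by (simp add: indicator_def)
  qed
  have "integral\<^sup>L lebesgue ?f = integral\<^sup>L (distr lebesgue lebesgue (\<lambda>y. 2 *\<^sub>R x - y)) ?f"
    by (simp only: distr_lebesgue_reflect)
  also have "\<dots> = (LINT y|lebesgue. ?f (2 *\<^sub>R x - y))"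
    using f by (intro integral_distr measurable_lebesgue_reflect)
      (simp add: set_integrable_def integrable_iff_bounded)
  also have "\<dots> = (LINT y:D|lebesgue. tchi E (2 *\<^sub>R x - y) * K (x - y))"
    by (simp only: reflect set_lebesgue_integral_def)
  finally have "(LINT y:D|lebesgue. tchi E y * K (x - y))
      = (LINT y:D|lebesgue. tchi E (2 *\<^sub>R x - y) * K (x - y))"
    by (simp only: set_lebesgue_integral_def)
  then show ?thesis
    using set_integral_add(2)[OF f f_reflect] by (simp add: distrib_right)
qed

lemma kernel_integral_outside_tangent_balls_le:
  fixes x z :: 'a
  assumes z: "x \<noteq> z" and \<epsilon>: "0 < \<epsilon>" and \<sigma>: "0 < \<sigma>"
  shows "(LINT y:(ball x \<sigma> - ball x \<epsilon>) \<inter> outside_tangent_balls z x|lebesgue. K (x - y))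
    \<le> Lam * (contact_upper DIM('a) s / dist z x * \<sigma> powr (1 - s))"
proof -
  let ?P = "outside_tangent_balls z x"
  let ?D = "(ball x \<sigma> - ball x \<epsilon>) \<inter> ?P"
  have D: "?D \<in> sets lebesgue" using outside_tangent_balls_sets_lebesgue[of z x] by auto
  have "(LINT y:?D|lebesgue. K (x - y)) \<le> Lam * (LINT y:?D|lebesgue. frac_kernel s (x - y))"
    by (rule kernel_integral_bounds(2)[OF \<epsilon> D]) auto
  also have "\<dots> \<le> Lam * (LINT y:?P \<inter> ball x \<sigma>|lebesgue. frac_kernel s (x - y))"
    using lam D
    by (intro mult_left_mono set_integral_mono_set frac_kernel_contact_le(1) s z \<sigma> frac_kernel_nonneg) auto
  also have "\<dots> \<le> Lam * (contact_upper DIM('a) s / dist z x * \<sigma> powr (1 - s))"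
    using lam by (intro mult_left_mono frac_kernel_contact_le(2) s z \<sigma>) auto
  finally show ?thesis .
qed

text \<open>The exterior ball and its reflection cancel in the symmetrized integral, which leaves
  only the thin region outside both.\<close>

lemma annulus_integral_ge_of_touching:
  fixes x z :: 'a
  assumes E: "E \<in> sets lebesgue" and z: "x \<noteq> z" "E \<inter> ball z (dist z x) = {}"
    and \<epsilon>: "0 < \<epsilon>" and \<sigma>: "0 < \<sigma>"
  shows "- (Lam * (contact_upper DIM('a) s / dist z x * \<sigma> powr (1 - s)))
    \<le> (LINT y:ball x \<sigma> - ball x \<epsilon>|lebesgue. tchi E y * K (x - y))"
proof -
  let ?D = "ball x \<sigma> - ball x \<epsilon>" and ?P = "outside_tangent_balls z x"
  let ?g = "\<lambda>y. (tchi E y + tchi E (2 *\<^sub>R x - y)) * K (x - y)"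
  have off: "x - y \<noteq> 0" if "y \<in> ?D" for y using that \<epsilon> by auto
  have P: "?D \<inter> ?P \<in> sets lebesgue" "?D - ?P \<in> sets lebesgue"
    using outside_tangent_balls_sets_lebesgue[of z x] by auto
  have "(\<lambda>y. tchi E y + tchi E (2 *\<^sub>R x - y)) \<in> borel_measurable lebesgue"
    using tchi_measurable[OF E] measurable_compose[OF measurable_lebesgue_reflect tchi_measurable[OF E]]
    by (intro borel_measurable_add) auto
  then have g: "set_integrable lebesgue A ?g" if "A \<in> sets lebesgue" "A \<subseteq> ?D" for A
    using that by (intro set_integrable_mult_kernel[OF \<epsilon>, where C = 2]) (auto simp: tchi_def)
  have "- 2 * (LINT y:?D \<inter> ?P|lebesgue. K (x - y)) = (LINT y:?D \<inter> ?P|lebesgue. - 2 * K (x - y))"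
    by (rule set_integral_mult_right[symmetric])
  also have "\<dots> \<le> (LINT y:?D \<inter> ?P|lebesgue. ?g y)"
    using P(1) K_nonneg[OF off]
    by (intro set_integral_mono g set_integrable_mult_right set_integrable_kernel[OF \<epsilon>] mult_right_mono)
      (auto simp: tchi_def)
  finally have outside: "- 2 * (LINT y:?D \<inter> ?P|lebesgue. K (x - y)) \<le> (LINT y:?D \<inter> ?P|lebesgue. ?g y)" .
  have "0 \<le> ?g y" if "y \<in> ?D - ?P" for y
    using that K_nonneg[OF off] tchi_add_tchi_reflect_nonneg[OF z(2)] by (intro mult_nonneg_nonneg) auto
  then have cancel: "0 \<le> (LINT y:?D - ?P|lebesgue. ?g y)"
    unfolding set_lebesgue_integral_def
    by (intro Bochner_Integration.integral_nonneg) (auto simp: indicator_def)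
  have "2 * (LINT y:?D|lebesgue. tchi E y * K (x - y))
      = (LINT y:?D \<inter> ?P|lebesgue. ?g y) + (LINT y:?D - ?P|lebesgue. ?g y)"
    unfolding annulus_integral_symmetrized[OF E \<epsilon>]
    using set_integral_Un[OF _ g[OF P(1)] g[OF P(2)]] by (simp add: Int_Diff_disjoint Int_Diff_Un)
  then show ?thesis
    using outside cancel kernel_integral_outside_tangent_balls_le[OF z(1) \<epsilon> \<sigma>] by linarith
qed

lemma nmc_ge_of_touching:
  fixes x z :: 'a
  assumes E: "E \<in> sets lebesgue" and z: "x \<noteq> z" "E \<inter> ball z (dist z x) = {}" and \<sigma>: "0 < \<sigma>"
  shows "ereal (nmc_trunc K E x \<sigma> - Lam * (contact_upper DIM('a) s / dist z x * \<sigma> powr (1 - s))) \<le> nmc K E x"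
proof -
  let ?\<eta> = "\<lambda>\<sigma>. Lam * (contact_upper DIM('a) s / dist z x * \<sigma> powr (1 - s))"
  have "nmc_trunc K E x \<sigma> - ?\<eta> \<sigma> \<le> nmc_trunc K E x \<epsilon>" if "0 < \<epsilon>" "\<epsilon> \<le> \<sigma>" for \<epsilon> \<sigma>
    using nmc_trunc_eq_add_annulus[OF E that, of x] annulus_integral_ge_of_touching[OF E z, of \<epsilon> \<sigma>] that
    by simp
  moreover have "(?\<eta> \<longlongrightarrow> 0) (at_right 0)"
  proof -
    have "((\<lambda>\<sigma>. \<sigma> powr (1 - s)) \<longlongrightarrow> 0) (at_right 0)" using s by real_asymp
    then show ?thesis by (intro tendsto_mult_right_zero)
  qed
  ultimately obtain l where l: "((\<lambda>\<epsilon>. ereal (nmc_trunc K E x \<epsilon>)) \<longlongrightarrow> l) (at_right 0)"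
    "\<forall>\<sigma>>0. ereal (nmc_trunc K E x \<sigma> - ?\<eta> \<sigma>) \<le> l"
    by (rule tendsto_ereal_almost_antimono) blast
  have "nmc K E x = l" unfolding nmc_def by (rule tendsto_Lim[OF _ l(1)]) simp
  then show ?thesis using l(2) \<sigma> by simp
qed

lemma nmc_ge_of_thin_exterior_ball:
  fixes x z :: 'a
  assumes E: "E \<in> sets lebesgue" and z: "x \<noteq> z" "E \<inter> ball z (dist z x) = {}"
    and \<theta>: "0 < \<theta>" "\<theta> * dist z x \<le> \<tau>"
    and thin: "\<forall>t\<in>{0<..\<tau> + dist z x}. ball_density E z t \<le> \<eta>"
  shows "ereal (thin_contact_coeff DIM('a) s lam Lam \<theta> \<eta> * (\<theta> * dist z x) powr (- s)
      - 2 * Lam * tail_upper DIM('a) s * \<tau> powr (- s)) \<le> nmc K E x"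
proof -
  let ?r = "dist z x"
  define \<sigma> where "\<sigma> = \<theta> * ?r"
  have r: "0 < ?r" using z(1) by simp
  then have \<sigma>: "0 < \<sigma>" "\<sigma> \<le> \<tau>" using \<theta> by (simp_all add: \<sigma>_def)
  have dens: "ball_density E x t \<le> (1 + 1 / \<theta>) ^ DIM('a) * \<eta>" if t: "\<sigma> \<le> t" "t \<le> \<tau>" for t
  proof -
    have t_pos: "0 < t" using t \<sigma> by simp
    have "ball_density E x t \<le> (1 + ?r / t) ^ DIM('a) * ball_density E z (t + ?r)"
      by (rule ball_density_le_shift[OF E t_pos order_refl])
    also have "\<dots> \<le> (1 + 1 / \<theta>) ^ DIM('a) * \<eta>"
    proof (intro mult_mono power_mono)
      show "1 + ?r / t \<le> 1 + 1 / \<theta>" using t(1) t_pos \<theta>(1) by (simp add: \<sigma>_def field_simps)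
      show "ball_density E z (t + ?r) \<le> \<eta>" using t t_pos r by (intro bspec[OF thin]) (simp add: add_pos_nonneg)
    qed (use t_pos \<theta>(1) ball_density_nonneg in auto)
    finally show ?thesis .
  qed
  have "\<sigma> powr (1 - s) = \<theta> * ?r * \<sigma> powr (- s)"
    using \<sigma> powr_add[of \<sigma> 1 "- s"] by (simp add: \<sigma>_def)
  then have "Lam * (contact_upper DIM('a) s / ?r * \<sigma> powr (1 - s))
      = Lam * contact_upper DIM('a) s * \<theta> * \<sigma> powr (- s)"
    using z(1) by simp
  then have touching: "ereal (nmc_trunc K E x \<sigma> - Lam * contact_upper DIM('a) s * \<theta> * \<sigma> powr (- s))
      \<le> nmc K E x"
    using nmc_ge_of_touching[OF E z \<sigma>(1)] by simp
  show ?thesis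
    unfolding \<sigma>_def[symmetric] thin_contact_coeff_def using nmc_trunc_ge_of_small_density[OF E \<sigma> dens]
    by (intro order_trans[OF _ touching]) (simp add: algebra_simps)
qed

end

subsection \<open>The choice of the density threshold\<close>

lemma ex_small_of_eventually_at_right_0:
  fixes P :: "real \<Rightarrow> bool"
  assumes "\<forall>\<^sub>F t in at_right 0. P t"
  obtains t where "0 < t" "t < 1" "P t"
proof -
  have "\<forall>\<^sub>F t in at_right (0::real). 0 < t \<and> t < 1" by (rule eventually_at_rightI[of 0 1]) auto
  with assms have "\<forall>\<^sub>F t in at_right 0. 0 < t \<and> t < 1 \<and> P t" by eventually_elim blast
  then show thesis using that eventually_happens'[OF trivial_limit_at_right_real] by blast
qed

text \<open>The factors 16 and 8 are those of the contact radius \<open>r \<le> R/16\<close> and of the scale \<open>R/8\<close> up to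
  which the density around the contact point is controlled.\<close>

lemma ex_thinness_threshold:
  fixes a b c M s :: real and n :: nat
  assumes s: "0 < s" and a: "0 < a"
  obtains \<theta> \<eta> where "0 < \<theta>" "\<theta> < 1" "0 < \<eta>" "\<eta> < 1" "0 < a - c * ((1 + 1 / \<theta>) ^ n * \<eta>) - b * \<theta>"
    "M < (a - c * ((1 + 1 / \<theta>) ^ n * \<eta>) - b * \<theta>) * (\<theta> / 16) powr (- s) - c * (1 / 8) powr (- s)"
proof -
  define A where "A \<theta> \<eta> = a - c * ((1 + 1 / \<theta>) ^ n * \<eta>) - b * \<theta>" for \<theta> \<eta>
  have "filterlim (\<lambda>\<theta>. (a - b * \<theta>) * (\<theta> / 16) powr (- s) - c * (1 / 8) powr (- s)) at_top (at_right 0)"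
    using a s by real_asymp
  then have "\<forall>\<^sub>F \<theta> in at_right 0. M < (a - b * \<theta>) * (\<theta> / 16) powr (- s) - c * (1 / 8) powr (- s)"
    by (simp add: filterlim_at_top_dense)
  moreover have "\<forall>\<^sub>F \<theta> in at_right 0. 0 < a - b * \<theta>" using a by real_asymp
  ultimately have "\<forall>\<^sub>F \<theta> in at_right 0. 0 < A \<theta> 0 \<and> M < A \<theta> 0 * (\<theta> / 16) powr (- s) - c * (1 / 8) powr (- s)"
    by eventually_elim (simp add: A_def)
  then obtain \<theta> where \<theta>: "0 < \<theta>" "\<theta> < 1"
    "0 < A \<theta> 0 \<and> M < A \<theta> 0 * (\<theta> / 16) powr (- s) - c * (1 / 8) powr (- s)"
    by (rule ex_small_of_eventually_at_right_0)
  have A: "(A \<theta> \<longlongrightarrow> A \<theta> 0) (at_right 0)" unfolding A_def by (intro tendsto_intros)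
  then have "((\<lambda>\<eta>. A \<theta> \<eta> * (\<theta> / 16) powr (- s) - c * (1 / 8) powr (- s))
      \<longlongrightarrow> A \<theta> 0 * (\<theta> / 16) powr (- s) - c * (1 / 8) powr (- s)) (at_right 0)"
    by (intro tendsto_diff tendsto_mult tendsto_const)
  then have "\<forall>\<^sub>F \<eta> in at_right 0. 0 < A \<theta> \<eta> \<and> M < A \<theta> \<eta> * (\<theta> / 16) powr (- s) - c * (1 / 8) powr (- s)"
    using A \<theta>(3) by (intro eventually_conj order_tendstoD(1)) auto
  then obtain \<eta> where "0 < \<eta>" "\<eta> < 1"
    "0 < A \<theta> \<eta> \<and> M < A \<theta> \<eta> * (\<theta> / 16) powr (- s) - c * (1 / 8) powr (- s)"
    by (rule ex_small_of_eventually_at_right_0)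
  with \<theta>(1,2) show thesis by (intro that[of \<theta> \<eta>]) (simp_all add: A_def)
qed

lemma threshold_rescale:
  fixes A M R c r s \<theta> :: real
  assumes A: "0 \<le> A" "M < A * (\<theta> / 16) powr (- s) - c * (1 / 8) powr (- s)"
    and s: "0 \<le> s" and \<theta>: "0 < \<theta>" and r: "0 < r" "r \<le> R / 16"
  shows "M * R powr (- s) < A * (\<theta> * r) powr (- s) - c * (R / 8) powr (- s)"
proof -
  have R: "0 < R" using r by simp
  have "M * R powr (- s) < (A * (\<theta> / 16) powr (- s) - c * (1 / 8) powr (- s)) * R powr (- s)"
    using A(2) R by (intro mult_strict_right_mono) auto
  also have "\<dots> = A * ((\<theta> / 16) powr (- s) * R powr (- s)) - c * ((1 / 8) powr (- s) * R powr (- s))"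
    by (simp only: left_diff_distrib mult.assoc)
  also have "\<dots> = A * (\<theta> * (R / 16)) powr (- s) - c * (R / 8) powr (- s)"
    using R \<theta> by (simp flip: powr_mult)
  also have "(\<theta> * (R / 16)) powr (- s) \<le> (\<theta> * r) powr (- s)"
    using \<theta> s r by (intro powr_mono2' mult_left_mono) auto
  finally show ?thesis using A(1) by (simp add: mult_left_mono)
qed

lemma nmc_gt_of_thin_exterior_ball:
  fixes s lam Lam M :: real
  assumes s: "0 < s" and lam: "0 < lam"
  obtains \<eta> where "0 < \<eta>" "\<eta> < 1"
    "\<And>(K :: 'a::euclidean_space \<Rightarrow> real) E x z R. elliptic_kernel K s lam Lam \<Longrightarrow> E \<in> sets lebesgue \<Longrightarrow>
      x \<noteq> z \<Longrightarrow> dist z x \<le> R / 16 \<Longrightarrow> E \<inter> ball z (dist z x) = {} \<Longrightarrow>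
      \<forall>t\<in>{0<..R / 4}. ball_density E z t \<le> \<eta> \<Longrightarrow> ereal (M * R powr (- s)) < nmc K E x"
proof -
  have "0 < lam * tail_lower DIM('a) s" using lam tail_lower_pos by simp
  then obtain \<theta> \<eta> where \<theta>: "0 < \<theta>" "\<theta> < 1" and \<eta>: "0 < \<eta>" "\<eta> < 1"
    and threshold: "0 < thin_contact_coeff DIM('a) s lam Lam \<theta> \<eta>"
      "M < thin_contact_coeff DIM('a) s lam Lam \<theta> \<eta> * (\<theta> / 16) powr (- s)
        - 2 * Lam * tail_upper DIM('a) s * (1 / 8) powr (- s)"
    unfolding thin_contact_coeff_def by (rule ex_thinness_threshold[OF s])
  show thesis
  proof (rule that[OF \<eta>])
    fix K :: "'a \<Rightarrow> real" and E :: "'a set" and x z R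
    assume K: "elliptic_kernel K s lam Lam" and E: "E \<in> sets lebesgue"
      and z: "x \<noteq> z" "dist z x \<le> R / 16" "E \<inter> ball z (dist z x) = {}"
      and thin: "\<forall>t\<in>{0<..R / 4}. ball_density E z t \<le> \<eta>"
    have r: "0 < dist z x" using z(1) by simp
    with z(2) have R: "0 < R" by linarith
    have "\<theta> * dist z x \<le> dist z x" using \<theta> by (simp add: mult_left_le_one_le)
    then have "\<theta> * dist z x \<le> R / 8" using z(2) R by linarith
    moreover have "\<forall>t\<in>{0<..R / 8 + dist z x}. ball_density E z t \<le> \<eta>"
      using z(2) R by (intro ballI bspec[OF thin]) simp
    ultimately show "ereal (M * R powr (- s)) < nmc K E x"
      using threshold_rescale[OF less_imp_le[OF threshold(1)] threshold(2) less_imp_le[OF s] \<theta>(1) r z(2)]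
      by (intro less_le_trans[OF _ elliptic_kernel.nmc_ge_of_thin_exterior_ball[OF K E z(1,3) \<theta>(1)]]) auto
  qed
qed

subsection \<open>Thin contact points\<close>

lemma ex_AE_point_of_measure_less:
  assumes "V \<in> fmeasurable M" "measure M V < measure M B" and P: "AE x in M. P x"
  obtains x where "x \<in> B" "x \<notin> V" "P x"
proof -
  have "\<exists>x\<in>B. x \<notin> V \<and> P x"
  proof (rule ccontr)
    assume "\<not> (\<exists>x\<in>B. x \<notin> V \<and> P x)"
    then have "\<forall>x. P x \<longrightarrow> x \<in> B \<longrightarrow> x \<in> V" by blast
    with P have "AE x in M. x \<in> B \<longrightarrow> x \<in> V" by (auto elim: eventually_mono)
    then have "emeasure M B \<le> emeasure M V" using assms(1) by (intro emeasure_mono_AE) auto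
    then have "measure M B \<le> measure M V"
      using assms(1) unfolding measure_def by (intro enn2real_mono) (auto simp: fmeasurable_def)
    then show False using assms(2) by simp
  qed
  then show thesis using that by blast
qed

lemma ex_thin_point_outside_closure:
  fixes E :: "'a::euclidean_space set"
  assumes E: "E \<in> sets lebesgue" and \<eta>: "0 < \<eta>" "\<eta> < 1" and T: "0 < T" "\<rho> + T \<le> R"
    and small: "measure lebesgue (E \<inter> ball p R) < \<eta> / 5 ^ DIM('a) * measure lebesgue (ball p \<rho>)"
    and null: "negligible ((closure E - E) \<inter> ball p \<rho>)"
  obtains z where "z \<in> ball p \<rho>" "z \<notin> closure E" "\<forall>t\<in>{0<..T}. ball_density E z t \<le> \<eta>"
proof -
  define U where "U = E \<inter> ball p R"
  have "U \<in> lmeasurable" unfolding U_def by (rule lmeasurable_Int_ball[OF E])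
  then obtain V where V: "V \<in> lmeasurable" "measure lebesgue V \<le> 5 ^ DIM('a) / \<eta> * measure lebesgue U"
    and dense: "{x. \<exists>t\<in>{0<..T}. \<eta> < ball_density U x t} \<subseteq> V"
    using \<eta>(1) by (rule maximal_inequality_ball)
  have "5 ^ DIM('a) / \<eta> * measure lebesgue U < measure lebesgue (ball p \<rho>)"
    using small \<eta>(1) by (simp add: U_def field_simps del: measure_completion)
  with V(2) have "measure lebesgue V < measure lebesgue (ball p \<rho>)" by linarith
  moreover have "AE x in lebesgue. x \<notin> (closure E - E) \<inter> ball p \<rho> \<and>
      (ball_density E x \<longlongrightarrow> indicator E x) (at_right 0)"
    using null lebesgue_density_theorem[OF E] by (auto simp: negligible_iff_null_sets dest: AE_not_in)
  ultimately obtain z where z: "z \<in> ball p \<rho>" "z \<notin> V"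
    "z \<notin> (closure E - E) \<inter> ball p \<rho> \<and> (ball_density E z \<longlongrightarrow> indicator E z) (at_right 0)"
    by (rule ex_AE_point_of_measure_less[OF V(1)])
  then have dens: "(ball_density E z \<longlongrightarrow> indicator E z) (at_right 0)" by blast
  have thin: "ball_density E z t \<le> \<eta>" if t: "0 < t" "t \<le> T" for t
  proof -
    have "ball z t \<subseteq> ball p R"
      using z(1) t T by (auto simp: ball_subset_ball_iff dist_commute)
    then have "U \<inter> ball z t = E \<inter> ball z t" by (auto simp: U_def)
    then have "ball_density E z t = ball_density U z t" by (simp only: ball_density_def)
    then show ?thesis using subsetD[OF dense, of z] z(2) t by force
  qed
  have "indicator E z \<le> \<eta>"
    using dens by (rule tendsto_upperbound)
      (use thin T in \<open>auto intro: eventually_at_rightI[of 0 T]\<close>)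
  then have "z \<notin> E" using \<eta>(2) by auto
  then show thesis using z thin by (intro that) auto
qed

lemma ex_nearest_frontier_point:
  fixes z :: "'a::euclidean_space"
  assumes z: "z \<notin> closure E" and "E \<noteq> {}"
  obtains x where "x \<in> frontier E" "\<forall>y\<in>closure E. dist z x \<le> dist z y"
proof -
  obtain x where x: "x \<in> closure E" "\<And>y. y \<in> closure E \<Longrightarrow> dist z x \<le> dist z y"
    using distance_attains_inf[of "closure E" z] \<open>E \<noteq> {}\<close> by (metis closed_closure closure_eq_empty)
  have "interior E \<inter> ball z (dist z x) = {}"
    using x(2) interior_subset[of E] closure_subset[of E] by (force simp: not_less)
  then have "interior E \<inter> closure (ball z (dist z x)) = {}" by (simp add: open_Int_closure_eq_empty)
  moreover have "x \<in> closure (ball z (dist z x))"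
  proof -
    have "x \<noteq> z" using x(1) z by auto
    then show ?thesis by simp
  qed
  ultimately have "x \<in> frontier E" using x(1) by (auto simp: frontier_def)
  then show thesis using x(2) by (intro that) auto
qed

lemma ex_thin_contact_point:
  fixes E :: "'a::euclidean_space set"
  assumes E: "E \<in> sets lebesgue" and p: "p \<in> closure E" and \<eta>: "0 < \<eta>" "\<eta> < 1" and T: "0 < T" "\<rho> + T \<le> R"
    and small: "measure lebesgue (E \<inter> ball p R) < \<eta> / 5 ^ DIM('a) * measure lebesgue (ball p \<rho>)"
    and null: "negligible ((closure E - E) \<inter> ball p \<rho>)"
  obtains x z where "x \<in> frontier E \<inter> ball p (2 * \<rho>)" "x \<noteq> z" "dist z x < \<rho>" "E \<inter> ball z (dist z x) = {}"
    "\<forall>t\<in>{0<..T}. ball_density E z t \<le> \<eta>"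
proof -
  obtain z where z: "z \<in> ball p \<rho>" "z \<notin> closure E"
    and thin: "\<forall>t\<in>{0<..T}. ball_density E z t \<le> \<eta>"
    by (rule ex_thin_point_outside_closure[OF E \<eta> T small null])
  have "E \<noteq> {}" using p by auto
  then obtain x where x: "x \<in> frontier E" "\<forall>y\<in>closure E. dist z x \<le> dist z y"
    by (rule ex_nearest_frontier_point[OF z(2)])
  have "dist z x < \<rho>" using x(2) p z(1) by (force simp add: dist_commute)
  moreover have "x \<in> ball p (2 * \<rho>)"
    using dist_triangle[of p x z] z(1) calculation by simp
  moreover have "x \<noteq> z" using x(1) z(2) by (auto simp: frontier_def)
  moreover have "E \<inter> ball z (dist z x) = {}" using x(2) closure_subset[of E] by force
  ultimately show thesis using x(1) thin by (intro that) auto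
qed

lemma exterior_touching_ballI:
  assumes "x \<noteq> z" "E \<inter> ball z (dist z x) = {}"
  shows "exterior_touching_ball E x"
  unfolding exterior_touching_ball_def using assms by (intro exI[of _ z] exI[of _ "dist z x"]) auto

lemma exterior_boundary_not_negligible:
  fixes s lam Lam M :: real
  assumes s: "0 < s" and lam: "0 < lam"
  obtains \<delta> where "0 < \<delta>" "\<And>(K :: 'a::euclidean_space \<Rightarrow> real) E p R. elliptic_kernel K s lam Lam \<Longrightarrow>
    E \<in> sets lebesgue \<Longrightarrow> p \<in> closure E \<Longrightarrow> 0 < R \<Longrightarrow> nmc_le_visc K E (ball p (R / 2)) (M * R powr (- s)) \<Longrightarrow>
    measure lebesgue (E \<inter> ball p R) < \<delta> * measure lebesgue (ball p R) \<Longrightarrow>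
    \<not> negligible ((closure E - E) \<inter> ball p (R / 4))"
proof -
  obtain \<eta> where \<eta>: "0 < \<eta>" "\<eta> < 1" and curvature_gt: "\<And>(K :: 'a \<Rightarrow> real) E x z R.
      elliptic_kernel K s lam Lam \<Longrightarrow> E \<in> sets lebesgue \<Longrightarrow> x \<noteq> z \<Longrightarrow> dist z x \<le> R / 16 \<Longrightarrow>
      E \<inter> ball z (dist z x) = {} \<Longrightarrow> \<forall>t\<in>{0<..R / 4}. ball_density E z t \<le> \<eta> \<Longrightarrow>
      ereal (M * R powr (- s)) < nmc K E x"
    using nmc_gt_of_thin_exterior_ball[OF s lam] by blast
  show thesis
  proof (rule that[of "\<eta> / 5 ^ DIM('a) / 16 ^ DIM('a)"])
    show "0 < \<eta> / 5 ^ DIM('a) / 16 ^ DIM('a)" using \<eta> by simp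
    fix K :: "'a \<Rightarrow> real" and E :: "'a set" and p R
    assume K: "elliptic_kernel K s lam Lam" and E: "E \<in> sets lebesgue" and p: "p \<in> closure E" and R: "0 < R"
      and visc: "nmc_le_visc K E (ball p (R / 2)) (M * R powr (- s))"
      and small: "measure lebesgue (E \<inter> ball p R) < \<eta> / 5 ^ DIM('a) / 16 ^ DIM('a) * measure lebesgue (ball p R)"
    have "measure lebesgue (ball p R) = 16 ^ DIM('a) * measure lebesgue (ball p (R / 16))"
      using R measure_lebesgue_ball_scale[of 16 "R / 16" p] by simp
    then have small_ratio: "measure lebesgue (E \<inter> ball p R)
        < \<eta> / 5 ^ DIM('a) * measure lebesgue (ball p (R / 16))"
      using small by simp
    have scales: "0 < R / 4" "R / 16 + R / 4 \<le> R" using R by simp_all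
    show "\<not> negligible ((closure E - E) \<inter> ball p (R / 4))"
    proof
      assume "negligible ((closure E - E) \<inter> ball p (R / 4))"
      then have null: "negligible ((closure E - E) \<inter> ball p (R / 16))"
        by (rule negligible_subset) (use R in auto)
      obtain x z where x: "x \<in> frontier E \<inter> ball p (2 * (R / 16))"
        and z: "x \<noteq> z" "dist z x < R / 16" "E \<inter> ball z (dist z x) = {}"
        and thin: "\<forall>t\<in>{0<..R / 4}. ball_density E z t \<le> \<eta>"
        by (rule ex_thin_contact_point[OF E p \<eta> scales small_ratio null])
      have "nmc K E x \<le> ereal (M * R powr (- s))"
        using visc x R exterior_touching_ballI[OF z(1,3)] by (auto simp: nmc_le_visc_def)
      moreover have "ereal (M * R powr (- s)) < nmc K E x"
        using z by (intro curvature_gt[OF K E _ _ _ thin]) auto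
      ultimately show False by simp
    qed
  qed
qed

theorem theorem1p6:
  fixes s lam Lam M :: real
  assumes "0 < s" "s < 1" "0 < lam" "lam \<le> Lam" "0 \<le> M"
  shows "\<exists>\<delta>>0. \<forall>(R::real) (K::'a::euclidean_space \<Rightarrow> real) (E::'a set).
     R > 0 \<longrightarrow>
     K \<in> borel_measurable lebesgue \<longrightarrow>
     (\<forall>y. y \<noteq> 0 \<longrightarrow> lam * norm y powr (-(real DIM('a)) - s) \<le> K y
                   \<and> K y \<le> Lam * norm y powr (-(real DIM('a)) - s)
                   \<and> K y = K (- y)) \<longrightarrow>
     E \<in> sets borel \<longrightarrow>
     0 \<in> frontier E \<longrightarrow>
     nmc_le_visc K E (ball 0 (R / 2)) (M * R powr (- s)) \<longrightarrow>
     measure lebesgue (E \<inter> ball 0 R) < \<delta> * measure lebesgue (ball (0::'a) R) \<longrightarrow>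
     (let S = {x \<in> frontier E \<inter> ball 0 (R / 4).
                 ((\<lambda>e. ereal (nmc_trunc K E x e)) \<longlongrightarrow> \<infinity>) (at_right 0)}
      in S \<in> sets lebesgue \<and> emeasure lebesgue S > 0)"
proof -
  obtain \<delta> where "0 < \<delta>" and exterior: "\<And>(K :: 'a \<Rightarrow> real) E p R. elliptic_kernel K s lam Lam \<Longrightarrow>
      E \<in> sets lebesgue \<Longrightarrow> p \<in> closure E \<Longrightarrow> 0 < R \<Longrightarrow> nmc_le_visc K E (ball p (R / 2)) (M * R powr (- s)) \<Longrightarrow>
      measure lebesgue (E \<inter> ball p R) < \<delta> * measure lebesgue (ball p R) \<Longrightarrow>
      \<not> negligible ((closure E - E) \<inter> ball p (R / 4))"
    using exterior_boundary_not_negligible[OF assms(1,3)] by blast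
  show ?thesis
  proof (intro exI[of _ \<delta>] conjI allI impI)
    fix R :: real and K :: "'a \<Rightarrow> real" and E :: "'a set"
    assume R: "R > 0" and K: "K \<in> borel_measurable lebesgue"
      "\<forall>y. y \<noteq> 0 \<longrightarrow> lam * norm y powr (-(real DIM('a)) - s) \<le> K y
         \<and> K y \<le> Lam * norm y powr (-(real DIM('a)) - s) \<and> K y = K (- y)"
      and E: "E \<in> sets borel" "0 \<in> frontier E"
      and visc: "nmc_le_visc K E (ball 0 (R / 2)) (M * R powr (- s))"
      and small: "measure lebesgue (E \<inter> ball 0 R) < \<delta> * measure lebesgue (ball (0::'a) R)"
    have "lam * frac_kernel s y \<le> K y" "K y \<le> Lam * frac_kernel s y" "K (- y) = K y" if "y \<noteq> 0" for y
      using K(2) that unfolding frac_kernel_def by metis+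
    then interpret elliptic_kernel K s lam Lam using assms K(1) by unfold_locales
    have EL: "E \<in> sets lebesgue" and B: "ball 0 (R / 4) \<in> sets lebesgue" and "0 \<in> closure E"
      using E by (auto simp: frontier_def)
    then have "\<not> negligible ((closure E - E) \<inter> ball 0 (R / 4))"
      by (intro exterior[OF elliptic_kernel_axioms _ _ R visc small])
    then show "let S = {x \<in> frontier E \<inter> ball 0 (R / 4).
        ((\<lambda>e. ereal (nmc_trunc K E x e)) \<longlongrightarrow> \<infinity>) (at_right 0)}
      in S \<in> sets lebesgue \<and> emeasure lebesgue S > 0"
      unfolding Let_def
      using infinite_curvature_set_measurable[OF EL B] emeasure_infinite_curvature_set_pos_iff[OF EL B] by blast
  qed (fact \<open>0 < \<delta>\<close>)
qed

end
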